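(* Let $r\ge4$ be an integer, and let $\mathcal E^r$ be the space of parametrised closed $C^r$ embeddings $S^1\to\mathbb R^3$ with positive curvature, with the $C^r$ topology. Let $\mathcal G^r\subset\mathcal E^r$ be the subset of curves whose torsion has only simple zeros. Then $\mathcal G^r$ is open and dense, hence residual, in $\mathcal E^r$, and its image is open and dense in the quotient $\mathcal E^r/\mathrm{Diff}^+(S^1)$ (quotient topology). Moreover, for every $\gamma\in\mathcal G^r$, with arclength reparametrisation $\widehat\gamma:\mathbb R/L\mathbb Z\to\mathbb R^3$ of length $L$, curvature $\widehat\kappa$ and torsion $\widehat\tau$: if $\widetilde\gamma:\mathbb R/L\mathbb Z\to\mathbb R^3$ is a closed unit-speed $C^4$ curve with curvature $\widetilde\kappa>0$ everywhere and torsion $\widetilde\tau$, and $\widetilde\kappa(s)=\widehat\kappa(s)$, $|\widetilde\tau(s)|=|\widehat\tau(s)|$ for all $s\in\mathbb R/L\mathbb Z$, then $\widetilde\gamma=Q\widehat\gamma+a$ for some $Q\in O(3)$ and $a\in\mathbb R^3$.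
   Context: $\mathcal E^r=\{\gamma\in C^r(S^1,\mathbb R^3):\gamma'\ne0,\ \gamma\text{ injective},\ \gamma'\times\gamma''\ne0\}$ with norm $\|\gamma\|_{C^r}=\max_{0\le i\le r}\sup|\gamma^{(i)}|$; curves in $\mathcal E^r$ are not required to be unit speed. The torsion is $\tau_\gamma=\det(\gamma',\gamma'',\gamma''')/|\gamma'\times\gamma''|^2$, and having only simple zeros is equivalent to all zeros of $D_\gamma=\det(\gamma',\gamma'',\gamma''')\in C^{r-3}$ being simple ($D_\gamma=0$, $D_\gamma'\neq0$); a torsion with no zeros qualifies. $\mathrm{Diff}^+(S^1)$ is the group of orientation-preserving $C^r$ diffeomorphisms of $S^1$ acting by reparametrisation. The arclength reparametrisation is $\widehat\gamma=\gamma\circ s_\gamma^{-1}$ with $s_\gamma(t)=\int_0^t|\gamma'|$, $L=L(\gamma)$. *)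

theory Defs
  imports "HOL-Analysis.Analysis"
begin

text \<open>
  Functions on a circle \<open>\<real>/p\<int>\<close> are represented by their \<open>p\<close>-periodic lifts to \<open>\<real>\<close>; the
  model of \<open>S^1\<close> is \<open>\<real>/\<int>\<close>.
\<close>

primrec nderiv :: "nat \<Rightarrow> (real \<Rightarrow> 'a::real_normed_vector) \<Rightarrow> real \<Rightarrow> 'a" where
  "nderiv 0 f = f"
| "nderiv (Suc n) f = (\<lambda>t. vector_derivative (nderiv n f) (at t))"

definition Cr :: "nat \<Rightarrow> (real \<Rightarrow> 'a::real_normed_vector) \<Rightarrow> bool" where
  "Cr r f \<longleftrightarrow> (\<forall>i<r. \<forall>t. nderiv i f differentiable (at t)) \<and> continuous_on UNIV (nderiv r f)"

definition periodic :: "real \<Rightarrow> (real \<Rightarrow> 'a) \<Rightarrow> bool" where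
  "periodic p f \<longleftrightarrow> (\<forall>t. f (t + p) = f t)"

definition curvature :: "(real \<Rightarrow> real^3) \<Rightarrow> real \<Rightarrow> real" where
  "curvature \<gamma> t = norm (cross3 (nderiv 1 \<gamma> t) (nderiv 2 \<gamma> t)) / norm (nderiv 1 \<gamma> t) ^ 3"

definition torsion :: "(real \<Rightarrow> real^3) \<Rightarrow> real \<Rightarrow> real" where
  "torsion \<gamma> t =
     det (vector [nderiv 1 \<gamma> t, nderiv 2 \<gamma> t, nderiv 3 \<gamma> t] :: real^3^3) /
     (norm (cross3 (nderiv 1 \<gamma> t) (nderiv 2 \<gamma> t)))\<^sup>2"

definition only_simple_zeros :: "(real \<Rightarrow> real) \<Rightarrow> bool" where
  "only_simple_zeros f \<longleftrightarrow> (\<forall>t. f t = 0 \<longrightarrow> deriv f t \<noteq> 0)"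

text \<open>The interval integral is oriented, so this is the usual signed quantity for \<open>t < 0\<close>.\<close>

definition arclength :: "(real \<Rightarrow> real^3) \<Rightarrow> real \<Rightarrow> real" where
  "arclength \<gamma> t = (LBINT u=0..ereal t. norm (nderiv 1 \<gamma> u))"

definition curve_length :: "(real \<Rightarrow> real^3) \<Rightarrow> real" where
  "curve_length \<gamma> = arclength \<gamma> 1"

definition arclength_reparam :: "(real \<Rightarrow> real^3) \<Rightarrow> real \<Rightarrow> real^3" where
  "arclength_reparam \<gamma> = \<gamma> \<circ> inv (arclength \<gamma>)"

definition Cr_curves :: "nat \<Rightarrow> (real \<Rightarrow> real^3) set" where
  "Cr_curves r = {\<gamma>. Cr r \<gamma> \<and> periodic 1 \<gamma>}"

definition Cr_norm :: "nat \<Rightarrow> (real \<Rightarrow> real^3) \<Rightarrow> real" where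
  "Cr_norm r \<gamma> = (MAX i\<in>{..r}. SUP t. norm (nderiv i \<gamma> t))"

text \<open>
  The value outside \<open>Cr_curves r\<close> is irrelevant; it is fixed because \<^locale>\<open>Metric_space\<close> asks for
  nonnegativity and symmetry on the whole type.
\<close>

definition Cr_dist :: "nat \<Rightarrow> (real \<Rightarrow> real^3) \<Rightarrow> (real \<Rightarrow> real^3) \<Rightarrow> real" where
  "Cr_dist r \<gamma> \<delta> =
     (if \<gamma> \<in> Cr_curves r \<and> \<delta> \<in> Cr_curves r then Cr_norm r (\<lambda>t. \<gamma> t - \<delta> t) else 0)"

definition Emb :: "nat \<Rightarrow> (real \<Rightarrow> real^3) set" where
  "Emb r = {\<gamma> \<in> Cr_curves r.
     (\<forall>t. nderiv 1 \<gamma> t \<noteq> 0) \<and> inj_on \<gamma> {0..<1} \<and>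
     (\<forall>t. cross3 (nderiv 1 \<gamma> t) (nderiv 2 \<gamma> t) \<noteq> 0)}"

definition Emb_top :: "nat \<Rightarrow> (real \<Rightarrow> real^3) topology" where
  "Emb_top r = subtopology (Metric_space.mtopology (Cr_curves r) (Cr_dist r)) (Emb r)"

definition Gen :: "nat \<Rightarrow> (real \<Rightarrow> real^3) set" where
  "Gen r = {\<gamma> \<in> Emb r. only_simple_zeros (torsion \<gamma>)}"

definition dense_in :: "'a topology \<Rightarrow> 'a set \<Rightarrow> bool" where
  "dense_in X S \<longleftrightarrow> S \<subseteq> topspace X \<and> X closure_of S = topspace X"

definition residual_in :: "'a topology \<Rightarrow> 'a set \<Rightarrow> bool" where
  "residual_in X S \<longleftrightarrow> S \<subseteq> topspace X \<and>
     (\<exists>\<U>. countable \<U> \<and> (\<forall>U\<in>\<U>. openin X U \<and> dense_in X U) \<and> topspace X \<inter> \<Inter>\<U> \<subseteq> S)"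

text \<open>
  An orientation-preserving diffeomorphism of \<open>\<real>/\<int>\<close> is represented by its lifts to \<open>\<real>\<close>. Lifts
  that differ by an integer translation act identically on \<open>1\<close>-periodic curves.
\<close>

definition Diff_plus :: "nat \<Rightarrow> (real \<Rightarrow> real) set" where
  "Diff_plus r = {\<phi>. bij \<phi> \<and> Cr r \<phi> \<and> Cr r (inv \<phi>) \<and> strict_mono \<phi> \<and> (\<forall>t. \<phi> (t + 1) = \<phi> t + 1)}"

definition reparam_class :: "nat \<Rightarrow> (real \<Rightarrow> real^3) \<Rightarrow> (real \<Rightarrow> real^3) set" where
  "reparam_class r \<gamma> = (\<lambda>\<phi>. \<gamma> \<circ> \<phi>) ` Diff_plus r"

definition quotient_topology :: "'a topology \<Rightarrow> ('a \<Rightarrow> 'b) \<Rightarrow> 'b topology" where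
  "quotient_topology X q =
     topology (\<lambda>U. U \<subseteq> q ` topspace X \<and> openin X {x \<in> topspace X. q x \<in> U})"

definition Emb_quotient :: "nat \<Rightarrow> (real \<Rightarrow> real^3) set topology" where
  "Emb_quotient r = quotient_topology (Emb_top r) (reparam_class r)"

lemma openin_quotient_topology:
  "openin (quotient_topology X q) U \<longleftrightarrow>
     U \<subseteq> q ` topspace X \<and> openin X {x \<in> topspace X. q x \<in> U}"
proof -
  let ?L = "\<lambda>U. U \<subseteq> q ` topspace X \<and> openin X {x \<in> topspace X. q x \<in> U}"
  have "istopology ?L"
    unfolding istopology_def
  proof (intro conjI allI impI)
    fix S T assume "?L S" "?L T"
    moreover have "{x \<in> topspace X. q x \<in> S \<inter> T} =
        {x \<in> topspace X. q x \<in> S} \<inter> {x \<in> topspace X. q x \<in> T}" by auto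
    ultimately show "S \<inter> T \<subseteq> q ` topspace X" "openin X {x \<in> topspace X. q x \<in> S \<inter> T}"
      by (auto)
  next
    fix K assume K: "\<forall>S\<in>K. ?L S"
    have "{x \<in> topspace X. q x \<in> \<Union>K} = (\<Union>S\<in>K. {x \<in> topspace X. q x \<in> S})" by auto
    then show "openin X {x \<in> topspace X. q x \<in> \<Union>K}" using K by auto
    show "\<Union>K \<subseteq> q ` topspace X" using K by auto
  qed
  then show ?thesis
    unfolding quotient_topology_def by simp
qed

lemma topspace_quotient_topology: "topspace (quotient_topology X q) = q ` topspace X"
proof (rule antisym)
  show "topspace (quotient_topology X q) \<subseteq> q ` topspace X"
    using openin_topspace[of "quotient_topology X q"] unfolding openin_quotient_topology
    by (rule conjunct1)
  have "{x \<in> topspace X. q x \<in> q ` topspace X} = topspace X" by auto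
  then have "openin (quotient_topology X q) (q ` topspace X)"
    by (simp add: openin_quotient_topology)
  then show "q ` topspace X \<subseteq> topspace (quotient_topology X q)"
    by (rule openin_subset)
qed

lemma quotient_map_quotient_topology: "quotient_map X (quotient_topology X q) q"
  by (simp add: quotient_map_def openin_quotient_topology topspace_quotient_topology)

lemma Cr_nderiv_has:
  assumes "Cr r f" "i < r"
  shows "(nderiv i f has_vector_derivative nderiv (Suc i) f t) (at t)"
  using assms by (simp add: Cr_def vector_derivative_works)

lemma Cr_nderiv_continuous:
  assumes "Cr r f" "i \<le> r"
  shows "continuous_on UNIV (nderiv i f)"
proof (cases "i = r")
  case False
  then have "i < r" using assms by simp
  then show ?thesis
    using assms(1) unfolding Cr_def
    by (auto simp: continuous_on_eq_continuous_at differentiable_imp_continuous_within)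
qed (use assms in \<open>simp add: Cr_def\<close>)

lemma nderiv_diff:
  assumes "Cr r f" "Cr r g" "i \<le> r"
  shows "nderiv i (\<lambda>t. f t - g t) = (\<lambda>t. nderiv i f t - nderiv i g t)"
  using assms(3)
proof (induction i)
  case (Suc i)
  then have IH: "nderiv i (\<lambda>t. f t - g t) = (\<lambda>t. nderiv i f t - nderiv i g t)" by simp
  have "((\<lambda>t. nderiv i f t - nderiv i g t) has_vector_derivative
          (nderiv (Suc i) f t - nderiv (Suc i) g t)) (at t)" for t
    using Suc.prems assms by (intro has_vector_derivative_diff Cr_nderiv_has[of r]) auto
  then have "vector_derivative (\<lambda>t. nderiv i f t - nderiv i g t) (at t) =
      nderiv (Suc i) f t - nderiv (Suc i) g t" for t
    by (rule vector_derivative_at)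
  then show ?case by (simp add: IH)
qed simp

lemma periodic_nderiv:
  assumes "Cr r f" "periodic p f" "i \<le> r"
  shows "periodic p (nderiv i f)"
  using assms(3)
proof (induction i)
  case (Suc i)
  then have IH: "nderiv i f (t + p) = nderiv i f t" for t by (simp add: periodic_def)
  have "nderiv (Suc i) f (t + p) = nderiv (Suc i) f t" for t
  proof -
    have "(nderiv i f has_vector_derivative nderiv (Suc i) f (t + p)) (at (t + p))"
      using Suc.prems by (intro Cr_nderiv_has[OF assms(1)]) auto
    then have "(nderiv i f \<circ> (\<lambda>t. t + p) has_vector_derivative
        1 *\<^sub>R nderiv (Suc i) f (t + p)) (at t)"
      by (intro vector_diff_chain_at) (auto intro!: derivative_eq_intros)
    moreover have "nderiv i f \<circ> (\<lambda>t. t + p) = nderiv i f" using IH by auto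
    ultimately show ?thesis
      using vector_derivative_at by fastforce
  qed
  then show ?case by (simp add: periodic_def)
qed (use assms in simp)

lemma periodic_bounded:
  fixes f :: "real \<Rightarrow> 'a::real_normed_vector"
  assumes "continuous_on UNIV f" "periodic 1 f"
  shows "bdd_above (range (\<lambda>t. norm (f t)))"
proof -
  interpret periodic_fun_simple' f
    using assms(2) by unfold_locales (simp add: periodic_def)
  have "compact (f ` {0..1})"
    by (intro compact_continuous_image continuous_on_subset[OF assms(1)]) auto
  then have "bounded (f ` {0..1})" by (rule compact_imp_bounded)
  then obtain B where "\<forall>x\<in>f ` {0..1}. norm x \<le> B"
    unfolding bounded_iff ..
  then have B: "norm (f t) \<le> B" if "t \<in> {0..1}" for t
    using that by blast
  have "norm (f t) \<le> B" for t
  proof -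
    have "f t = f (frac t + of_int \<lfloor>t\<rfloor>)" by (simp add: frac_def)
    also have "\<dots> = f (frac t)" by (rule plus_of_int)
    finally show ?thesis using B[of "frac t"] frac_lt_1[of t] by simp
  qed
  then show ?thesis by (auto simp: bdd_above_def)
qed

lemma Cr_dist_le_iff:
  assumes "\<gamma> \<in> Cr_curves r" "\<delta> \<in> Cr_curves r"
  shows "Cr_dist r \<gamma> \<delta> \<le> B \<longleftrightarrow> (\<forall>i\<le>r. \<forall>t. norm (nderiv i \<gamma> t - nderiv i \<delta> t) \<le> B)"
proof -
  have cr: "Cr r \<gamma>" "Cr r \<delta>" "periodic 1 \<gamma>" "periodic 1 \<delta>"
    using assms by (auto simp: Cr_curves_def)
  have bdd: "bdd_above (range (\<lambda>t. norm (nderiv i \<gamma> t - nderiv i \<delta> t)))" if "i \<le> r" for i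
  proof (rule periodic_bounded)
    show "continuous_on UNIV (\<lambda>t. nderiv i \<gamma> t - nderiv i \<delta> t)"
      using that cr by (intro continuous_on_diff Cr_nderiv_continuous)
    show "periodic 1 (\<lambda>t. nderiv i \<gamma> t - nderiv i \<delta> t)"
      using periodic_nderiv[OF cr(1,3) that] periodic_nderiv[OF cr(2,4) that]
      by (simp add: periodic_def)
  qed
  have "(SUP t. norm (nderiv i (\<lambda>t. \<gamma> t - \<delta> t) t)) \<le> B \<longleftrightarrow>
      (\<forall>t. norm (nderiv i \<gamma> t - nderiv i \<delta> t) \<le> B)" if "i \<le> r" for i
    unfolding nderiv_diff[OF cr(1,2) that]
    using cSUP_le_iff[OF _ bdd[OF that]] by auto
  then show ?thesis
    using assms by (auto simp: Cr_dist_def Cr_norm_def)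
qed

lemma Metric_space_Cr: "Metric_space (Cr_curves r) (Cr_dist r)"
proof
  have le: "norm (nderiv i \<gamma> t - nderiv i \<delta> t) \<le> Cr_dist r \<gamma> \<delta>"
    if "\<gamma> \<in> Cr_curves r" "\<delta> \<in> Cr_curves r" "i \<le> r" for \<gamma> \<delta> i t
    using Cr_dist_le_iff[of \<gamma> r \<delta> "Cr_dist r \<gamma> \<delta>"] that by blast
  have sym: "Cr_dist r \<gamma> \<delta> \<le> Cr_dist r \<delta> \<gamma>"
    if "\<gamma> \<in> Cr_curves r" "\<delta> \<in> Cr_curves r" for \<gamma> \<delta>
    using Cr_dist_le_iff[OF that] le[OF that(2,1)] by (simp add: norm_minus_commute)
  fix \<gamma> \<delta> :: "real \<Rightarrow> real^3"
  show "0 \<le> Cr_dist r \<gamma> \<delta>"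
  proof (cases "\<gamma> \<in> Cr_curves r \<and> \<delta> \<in> Cr_curves r")
    case True
    then show ?thesis
      using le[of \<gamma> \<delta> 0 0] norm_ge_zero order_trans by blast
  qed (auto simp: Cr_dist_def)
  show "Cr_dist r \<gamma> \<delta> = Cr_dist r \<delta> \<gamma>"
  proof (cases "\<gamma> \<in> Cr_curves r \<and> \<delta> \<in> Cr_curves r")
    case True
    then show ?thesis using sym by (blast intro: antisym)
  qed (auto simp: Cr_dist_def)
  show "Cr_dist r \<gamma> \<delta> = 0 \<longleftrightarrow> \<gamma> = \<delta>" if "\<gamma> \<in> Cr_curves r" "\<delta> \<in> Cr_curves r"
  proof
    assume 0: "Cr_dist r \<gamma> \<delta> = 0"
    have "\<gamma> t = \<delta> t" for t using le[OF that, of 0 t] by (simp add: 0)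
    then show "\<gamma> = \<delta>" by auto
  next
    assume "\<gamma> = \<delta>"
    then have "Cr_dist r \<gamma> \<delta> \<le> 0" using Cr_dist_le_iff[OF that, of 0] by simp
    then show "Cr_dist r \<gamma> \<delta> = 0" using \<open>0 \<le> Cr_dist r \<gamma> \<delta>\<close> by simp
  qed
  fix \<epsilon> :: "real \<Rightarrow> real^3"
  assume *: "\<gamma> \<in> Cr_curves r" "\<delta> \<in> Cr_curves r" "\<epsilon> \<in> Cr_curves r"
  show "Cr_dist r \<gamma> \<epsilon> \<le> Cr_dist r \<gamma> \<delta> + Cr_dist r \<delta> \<epsilon>"
    unfolding Cr_dist_le_iff[OF *(1,3)]
  proof (intro allI impI)
    fix i t assume "i \<le> r"
    have "nderiv i \<gamma> t - nderiv i \<epsilon> t =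
        (nderiv i \<gamma> t - nderiv i \<delta> t) + (nderiv i \<delta> t - nderiv i \<epsilon> t)" by simp
    also have "norm \<dots> \<le> Cr_dist r \<gamma> \<delta> + Cr_dist r \<delta> \<epsilon>"
      using le[OF *(1,2) \<open>i \<le> r\<close>] le[OF *(2,3) \<open>i \<le> r\<close>] by (intro norm_triangle_mono)
    finally show "norm (nderiv i \<gamma> t - nderiv i \<epsilon> t) \<le> Cr_dist r \<gamma> \<delta> + Cr_dist r \<delta> \<epsilon>" .
  qed
qed

lemma topspace_Emb_top: "topspace (Emb_top r) = Emb r"
proof -
  interpret Metric_space "Cr_curves r" "Cr_dist r" by (rule Metric_space_Cr)
  show ?thesis by (auto simp: Emb_top_def Emb_def)
qed

end

theory Submission
  imports Defs
begin

text \<open>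
  Let \<open>D = det (\<gamma>', \<gamma>'', \<gamma>''')\<close>; its derivative is \<open>det (\<gamma>', \<gamma>'', \<gamma>'''')\<close>, so having only simple
  zeros is the nonvanishing of a continuous function of the 4-jet on a compact circle. This gives
  openness. For density, near a parameter \<open>a\<close> add \<open>c p v\<close> with \<open>v = (\<gamma>' \<times> \<gamma>'') a\<close> and a scalar
  trigonometric polynomial \<open>p\<close> with \<open>p' a = p'' a = 0 \<noteq> p''' a\<close>. As the direction \<open>v\<close> is fixed, \<open>D\<close>
  becomes \<open>D + c G\<close> with \<open>G \<noteq> 0\<close> near \<open>a\<close>, and a double zero there makes \<open>c\<close> a critical value
  of \<open>- D / G\<close>; by Sard's theorem arbitrarily small \<open>c\<close> avoid this. Finitely many such
  steps cover the circle, each small enough not to destroy the earlier ones. Torsion is invariant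
  under reparametrisation, so the generic set is saturated and everything descends to the quotient.

  For rigidity, \<open>\<bar>\<tau>~\<bar> = \<bar>\<tau>\<bar>\<close> with simple zeros forces \<open>(\<tau>~, \<tau>~') = \<plusminus> (\<tau>, \<tau>')\<close> pointwise; the two
  alternatives define disjoint closed sets covering \<open>\<real>\<close>, so one sign holds globally, and the
  uniqueness theorem for the Frenet equations applies (with binormal \<open>- B\<close> in the negative case).
\<close>

section \<open>Frenet frames\<close>

text \<open>\<open>One_nat_def\<close> rewrites \<open>nderiv 1\<close> to
  \<open>nderiv (Suc 0)\<close>, which this rule would unfold into a raw
  \<open>vector_derivative\<close>.\<close>

declare nderiv.simps(2) [simp del]

section \<open>Cross products and orthonormal frames in space\<close>

lemma has_vector_derivative_cross3:
  assumes "(f has_vector_derivative f') (at t within S)" "(g has_vector_derivative g') (at t within S)"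
  shows "((\<lambda>t. cross3 (f t) (g t)) has_vector_derivative cross3 (f t) g' + cross3 f' (g t)) (at t within S)"
  using bounded_bilinear.has_vector_derivative[OF bilinear_cross[unfolded bilinear_conv_bounded_bilinear] assms] .

lemmas has_vector_derivative_inner = bounded_bilinear.has_vector_derivative[OF bounded_bilinear_inner]

lemma cross3_orthonormal:
  assumes "T \<bullet> T = 1" "N \<bullet> N = 1" "T \<bullet> N = 0"
  shows "cross3 T N \<bullet> cross3 T N = 1" "cross3 (cross3 T N) T = N" "cross3 (cross3 T N) N = - T"
proof -
  show "cross3 T N \<bullet> cross3 T N = 1"
    using norm_cross_dot[of T N] assms by (simp add: power2_norm_eq_inner power_mult_distrib)
  have "cross3 (cross3 T N) x = - cross3 x (cross3 T N)" for x by (rule cross_skew)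
  then show "cross3 (cross3 T N) T = N" "cross3 (cross3 T N) N = - T"
    using assms by (simp_all add: Lagrange inner_commute)
qed

text \<open>For a unit vector \<open>B\<close>, the vector \<open>x\<close> minus its
  \<open>B\<close>-component is the double cross product of \<open>B\<close>, \<open>x\<close>,
  \<open>B\<close>. Evaluating both products by the triple product expansion produces the
  coordinates along \<open>T\<close> and \<open>N\<close>.\<close>

lemma orthonormal_expansion:
  assumes "T \<bullet> T = 1" "N \<bullet> N = 1" "T \<bullet> N = 0"
  shows "x = (T \<bullet> x) *\<^sub>R T + (N \<bullet> x) *\<^sub>R N + (cross3 T N \<bullet> x) *\<^sub>R cross3 T N"
proof -
  let ?B = "cross3 T N"
  have "cross3 ?B (cross3 x ?B) = (?B \<bullet> ?B) *\<^sub>R x - (?B \<bullet> x) *\<^sub>R ?B"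
    by (rule Lagrange)
  moreover have "cross3 x ?B = (x \<bullet> N) *\<^sub>R T - (x \<bullet> T) *\<^sub>R N" by (rule Lagrange)
  ultimately have "x - (?B \<bullet> x) *\<^sub>R ?B = cross3 ?B ((x \<bullet> N) *\<^sub>R T - (x \<bullet> T) *\<^sub>R N)"
    using cross3_orthonormal(1)[OF assms] by simp
  also have "\<dots> = (x \<bullet> N) *\<^sub>R N + (x \<bullet> T) *\<^sub>R T"
    using cross3_orthonormal(2,3)[OF assms]
    by (simp add: Cross3.right_diff_distrib cross_mult_right)
  finally show ?thesis by (simp add: algebra_simps inner_commute)
qed

text \<open>Both signs of the binormal are allowed, in order to compare curves of opposite torsion.\<close>

definition frenet_frame ::
  "(real \<Rightarrow> real) \<Rightarrow> (real \<Rightarrow> real) \<Rightarrow> (real \<Rightarrow> real^3) \<Rightarrow> (real \<Rightarrow> real^3) \<Rightarrow> (real \<Rightarrow> real^3) \<Rightarrow> bool" where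
  "frenet_frame \<kappa> \<tau> T N B \<longleftrightarrow>
     (\<forall>t. (T has_vector_derivative \<kappa> t *\<^sub>R N t) (at t) \<and>
          (N has_vector_derivative \<tau> t *\<^sub>R B t - \<kappa> t *\<^sub>R T t) (at t) \<and>
          (B has_vector_derivative - \<tau> t *\<^sub>R N t) (at t) \<and>
          T t \<bullet> T t = 1 \<and> N t \<bullet> N t = 1 \<and> T t \<bullet> N t = 0 \<and>
          (B t = cross3 (T t) (N t) \<or> B t = - cross3 (T t) (N t)))"

text \<open>This brings curves of opposite torsion under the same Frenet equations. The isometry
  matching a flipped frame with an unflipped one reverses orientation.\<close>

lemma frenet_frame_flip:
  assumes "frenet_frame \<kappa> \<tau> T N B"
  shows "frenet_frame \<kappa> (\<lambda>t. - \<tau> t) T N (\<lambda>t. - B t)"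
proof -
  have "((\<lambda>t. - B t) has_vector_derivative \<tau> t *\<^sub>R N t) (at t)" for t
    using assms has_vector_derivative_minus[of B "- \<tau> t *\<^sub>R N t" "at t"]
    unfolding frenet_frame_def by simp
  then show ?thesis using assms unfolding frenet_frame_def by auto
qed

lemma frenet_frame_orthonormal:
  assumes "frenet_frame \<kappa> \<tau> T N B"
  shows "T t \<bullet> T t = 1" "N t \<bullet> N t = 1" "B t \<bullet> B t = 1"
    "T t \<bullet> N t = 0" "T t \<bullet> B t = 0" "N t \<bullet> B t = 0"
    "x = (T t \<bullet> x) *\<^sub>R T t + (N t \<bullet> x) *\<^sub>R N t + (B t \<bullet> x) *\<^sub>R B t"
proof -
  have *: "T t \<bullet> T t = 1" "N t \<bullet> N t = 1" "T t \<bullet> N t = 0"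
    "B t = cross3 (T t) (N t) \<or> B t = - cross3 (T t) (N t)"
    using assms unfolding frenet_frame_def by auto
  show "T t \<bullet> T t = 1" "N t \<bullet> N t = 1" "B t \<bullet> B t = 1"
    "T t \<bullet> N t = 0" "T t \<bullet> B t = 0" "N t \<bullet> B t = 0"
    using * cross3_orthonormal[OF *(1-3)] by (auto simp: dot_cross_self)
  show "x = (T t \<bullet> x) *\<^sub>R T t + (N t \<bullet> x) *\<^sub>R N t + (B t \<bullet> x) *\<^sub>R B t"
    using *(4) orthonormal_expansion[OF *(1-3), of x] by auto
qed

text \<open>
  Writing \<open>F\<close>, \<open>F'\<close> for the matrices whose rows are the two frames, \<open>F'\<^sup>T F\<close> is constant,
  because both solve the same linear equation with a skew-symmetric coefficient matrix.
\<close>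

lemma frenet_frames_congruent:
  assumes 1: "frenet_frame \<kappa> \<tau> T N B" and 2: "frenet_frame \<kappa> \<tau> T' N' B'"
  obtains Q :: "real^3^3" where "orthogonal_matrix Q" "\<And>t. T' t = Q *v T t"
proof -
  \<comment> \<open>\<open>f t\<close> is the linear map carrying the first frame at
    \<open>t\<close> to the second.\<close>
  define f where "f t x = (T t \<bullet> x) *\<^sub>R T' t + (N t \<bullet> x) *\<^sub>R N' t + (B t \<bullet> x) *\<^sub>R B' t" for t x
  note d1 = 1[unfolded frenet_frame_def, rule_format] and d2 = 2[unfolded frenet_frame_def, rule_format]
  have inner_d: "((\<lambda>t. X t \<bullet> x) has_real_derivative X' \<bullet> x) (at t)"
    if "(X has_vector_derivative X') (at t)" for X :: "real \<Rightarrow> real^3" and X' t x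
    using has_vector_derivative_inner[OF that has_vector_derivative_const[of x]]
    by (simp add: has_real_derivative_iff_has_vector_derivative)
  have "(f t x) = f 0 x" for t x
  proof -
    have "((\<lambda>t. f t x) has_vector_derivative 0) (at t)" for t
    proof -
      note D = d1[of t] d2[of t]
      have "((\<lambda>t. f t x) has_vector_derivative
          ((T t \<bullet> x) *\<^sub>R (\<kappa> t *\<^sub>R N' t) + ((\<kappa> t *\<^sub>R N t) \<bullet> x) *\<^sub>R T' t) +
          ((N t \<bullet> x) *\<^sub>R (\<tau> t *\<^sub>R B' t - \<kappa> t *\<^sub>R T' t) + ((\<tau> t *\<^sub>R B t - \<kappa> t *\<^sub>R T t) \<bullet> x) *\<^sub>R N' t) +
          ((B t \<bullet> x) *\<^sub>R (- \<tau> t *\<^sub>R N' t) + ((- \<tau> t *\<^sub>R N t) \<bullet> x) *\<^sub>R B' t)) (at t)"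
        unfolding f_def using D
        by (intro has_vector_derivative_add has_vector_derivative_scaleR inner_d) auto
      \<comment> \<open>Each \<open>\<kappa>\<close> or \<open>\<tau>\<close> term meets its
        negative, by skew symmetry of the Frenet matrix.\<close>
      then show ?thesis by (simp add: algebra_simps)
    qed
    then show ?thesis
      using has_vector_derivative_zero_constant[of UNIV "\<lambda>t. f t x"] by (metis UNIV_I convex_UNIV)
  qed
  note const = this
  note o1 = frenet_frame_orthonormal[OF 1] and o2 = frenet_frame_orthonormal[OF 2]
  have lin: "linear (f 0)"
    unfolding f_def by (intro linearI) (simp_all add: algebra_simps)
  \<comment> \<open>Parseval for both frames at parameter 0.\<close>
  have "f 0 x \<bullet> f 0 y = x \<bullet> y" for x y
  proof -
    have "f 0 x \<bullet> f 0 y = (T 0 \<bullet> x) * (T 0 \<bullet> y) + (N 0 \<bullet> x) * (N 0 \<bullet> y) + (B 0 \<bullet> x) * (B 0 \<bullet> y)"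
      unfolding f_def using o2(1-6)[of 0] by (simp add: inner_add_left inner_add_right inner_commute)
    also have "\<dots> = x \<bullet> ((T 0 \<bullet> y) *\<^sub>R T 0 + (N 0 \<bullet> y) *\<^sub>R N 0 + (B 0 \<bullet> y) *\<^sub>R B 0)"
      by (simp add: inner_add_right inner_commute mult.commute)
    also have "\<dots> = x \<bullet> y" using o1(7)[of y 0] by simp
    finally show ?thesis .
  qed
  then have "orthogonal_transformation (f 0)"
    using lin by (simp add: orthogonal_transformation_def)
  moreover have "T' t = matrix (f 0) *v T t" for t
  proof -
    have "f t (T t) = T' t" unfolding f_def using o1(1-6)[of t] by (simp add: inner_commute)
    then show ?thesis using const[of t "T t"] matrix_works[of "f 0" "T t"] lin
      by (simp add: linear_def scalar_mult_eq_scaleR[abs_def])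
  qed
  ultimately show ?thesis
    using that[of "matrix (f 0)"] by (simp only: orthogonal_transformation_matrix)
qed

section \<open>Frenet equations and congruence of unit-speed curves\<close>

text \<open>Differentiating \<open>|c'| = 1\<close> twice fixes the tangential parts of the second
  and third derivatives; the binormal part of the third derivative is the torsion up to a factor
  \<open>\<kappa>\<close>.\<close>

lemma unit_speed_frenet_frame:
  fixes c :: "real \<Rightarrow> real^3"
  assumes d: "\<And>i t. i < 3 \<Longrightarrow> nderiv i c differentiable (at t)"
    and unit: "\<And>t. norm (nderiv 1 c t) = 1" and pos: "\<And>t. curvature c t > 0"
  defines "N \<equiv> \<lambda>t. inverse (curvature c t) *\<^sub>R nderiv 2 c t"
  shows "frenet_frame (curvature c) (torsion c) (nderiv 1 c) N (\<lambda>t. cross3 (nderiv 1 c t) (N t))"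
proof -
  have hd: "(nderiv i c has_vector_derivative nderiv (Suc i) c t) (at t)" if "i < 3" for i t
    using d[OF that, of t] by (simp add: vector_derivative_works nderiv.simps(2))
  have D1: "(nderiv 1 c has_vector_derivative nderiv 2 c t) (at t)"
    and D2: "(nderiv 2 c has_vector_derivative nderiv 3 c t) (at t)" for t
    using hd[of 1 t] hd[of 2 t] by (simp_all add: numeral_eq_Suc)
  have u11: "nderiv 1 c t \<bullet> nderiv 1 c t = 1" for t using unit[of t] by (simp add: norm_eq_1)
  have u12: "nderiv 1 c t \<bullet> nderiv 2 c t = 0" for t
  proof -
    have "((\<lambda>t. nderiv 1 c t \<bullet> nderiv 1 c t) has_vector_derivative
        nderiv 1 c t \<bullet> nderiv 2 c t + nderiv 2 c t \<bullet> nderiv 1 c t) (at t)"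
      by (intro has_vector_derivative_inner D1)
    then have "((\<lambda>t. 1::real) has_vector_derivative
        nderiv 1 c t \<bullet> nderiv 2 c t + nderiv 2 c t \<bullet> nderiv 1 c t) (at t)"
      by (simp only: u11)
    from vector_derivative_unique_at[OF this has_vector_derivative_const]
    show ?thesis by (simp add: inner_commute)
  qed
  have u13: "nderiv 1 c t \<bullet> nderiv 3 c t = - (nderiv 2 c t \<bullet> nderiv 2 c t)" for t
  proof -
    have "((\<lambda>t. nderiv 1 c t \<bullet> nderiv 2 c t) has_vector_derivative
        nderiv 1 c t \<bullet> nderiv 3 c t + nderiv 2 c t \<bullet> nderiv 2 c t) (at t)"
      by (intro has_vector_derivative_inner D1 D2)
    then have "((\<lambda>t. 0::real) has_vector_derivative
        nderiv 1 c t \<bullet> nderiv 3 c t + nderiv 2 c t \<bullet> nderiv 2 c t) (at t)"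
      by (simp only: u12)
    from vector_derivative_unique_at[OF this has_vector_derivative_const]
    show ?thesis by simp
  qed
  have nc: "norm (cross3 (nderiv 1 c t) (nderiv 2 c t)) = norm (nderiv 2 c t)" for t
    using norm_cross_dot[of "nderiv 1 c t" "nderiv 2 c t"] unit[of t] u12[of t]
    by simp
  have curv: "curvature c t = sqrt (nderiv 2 c t \<bullet> nderiv 2 c t)" for t
    unfolding curvature_def nc using unit[of t] by (simp add: norm_eq_sqrt_inner)
  define \<kappa> where "\<kappa> = curvature c"
  have kpos: "\<kappa> t > 0" for t using pos by (simp add: \<kappa>_def)
  have k2: "nderiv 2 c t \<bullet> nderiv 2 c t = \<kappa> t ^ 2" for t by (simp add: \<kappa>_def curv)
  have dk: "((\<lambda>t. inverse (\<kappa> t)) has_real_derivative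
      - (nderiv 2 c t \<bullet> nderiv 3 c t) / \<kappa> t ^ 3) (at t)" for t
  proof -
    have "((\<lambda>t. nderiv 2 c t \<bullet> nderiv 2 c t) has_real_derivative
        nderiv 2 c t \<bullet> nderiv 3 c t + nderiv 3 c t \<bullet> nderiv 2 c t) (at t)"
      unfolding has_real_derivative_iff_has_vector_derivative
      by (intro has_vector_derivative_inner D2)
    then have 1: "((\<lambda>t. nderiv 2 c t \<bullet> nderiv 2 c t) has_real_derivative
        2 * (nderiv 2 c t \<bullet> nderiv 3 c t)) (at t)"
      by (simp add: inner_commute)
    have pos2: "nderiv 2 c t \<bullet> nderiv 2 c t > 0" using k2[of t] kpos[of t] by simp
    \<comment> \<open>Writing \<open>\<kappa>\<close> as a square root of an inner product makes it
      differentiable, because it is positive.\<close>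
    have "\<kappa> = (\<lambda>t. sqrt (nderiv 2 c t \<bullet> nderiv 2 c t))" by (simp add: \<kappa>_def curv fun_eq_iff)
    with DERIV_chain2[OF DERIV_real_sqrt[OF pos2] 1]
    have "(\<kappa> has_real_derivative inverse (\<kappa> t) / 2 * (2 * (nderiv 2 c t \<bullet> nderiv 3 c t))) (at t)"
      by (simp only:)
    then have "(\<kappa> has_real_derivative (nderiv 2 c t \<bullet> nderiv 3 c t) / \<kappa> t) (at t)"
      by (simp add: field_simps)
    then show ?thesis
      using kpos[of t] by (auto intro!: derivative_eq_intros simp: field_simps power3_eq_cube power2_eq_square)
  qed
  have N: "N t = inverse (\<kappa> t) *\<^sub>R nderiv 2 c t" for t by (simp add: N_def \<kappa>_def)
  have NN: "N t \<bullet> N t = 1" "nderiv 1 c t \<bullet> N t = 0" for t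
    using k2[of t] kpos[of t] u12[of t] by (simp_all add: N power2_eq_square field_simps)
  have tor: "torsion c t = (cross3 (nderiv 1 c t) (nderiv 2 c t) \<bullet> nderiv 3 c t) / \<kappa> t ^ 2" for t
    unfolding torsion_def nc
    by (simp add: dot_cross_det[symmetric] power2_norm_eq_inner k2) (simp add: cross3_simps)
  have dN: "(N has_vector_derivative
      torsion c t *\<^sub>R cross3 (nderiv 1 c t) (N t) - \<kappa> t *\<^sub>R nderiv 1 c t) (at t)" for t
  proof -
    have "(N has_vector_derivative inverse (\<kappa> t) *\<^sub>R nderiv 3 c t
        + (- (nderiv 2 c t \<bullet> nderiv 3 c t) / \<kappa> t ^ 3) *\<^sub>R nderiv 2 c t) (at t)"
      unfolding N[abs_def] by (intro has_vector_derivative_scaleR dk D2)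
    moreover have "inverse (\<kappa> t) *\<^sub>R nderiv 3 c t
        + (- (nderiv 2 c t \<bullet> nderiv 3 c t) / \<kappa> t ^ 3) *\<^sub>R nderiv 2 c t
      = torsion c t *\<^sub>R cross3 (nderiv 1 c t) (N t) - \<kappa> t *\<^sub>R nderiv 1 c t"
    proof -
      \<comment> \<open>In frame coordinates the \<open>N\<close>-component of the third derivative
        is cancelled by the term from the derivative of \<open>1 / \<kappa>\<close>.\<close>
      have "nderiv 3 c t = (nderiv 1 c t \<bullet> nderiv 3 c t) *\<^sub>R nderiv 1 c t
          + (N t \<bullet> nderiv 3 c t) *\<^sub>R N t
          + (cross3 (nderiv 1 c t) (N t) \<bullet> nderiv 3 c t) *\<^sub>R cross3 (nderiv 1 c t) (N t)"
        by (rule orthonormal_expansion[OF u11 NN])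
      then have "inverse (\<kappa> t) *\<^sub>R nderiv 3 c t = inverse (\<kappa> t) *\<^sub>R ((- (\<kappa> t ^ 2)) *\<^sub>R nderiv 1 c t
          + (N t \<bullet> nderiv 3 c t) *\<^sub>R N t
          + (cross3 (nderiv 1 c t) (N t) \<bullet> nderiv 3 c t) *\<^sub>R cross3 (nderiv 1 c t) (N t))"
        using u13[of t] k2[of t] by simp
      then show ?thesis using kpos[of t]
        by (simp add: N tor cross_mult_right algebra_simps power2_eq_square power3_eq_cube divide_simps)
    qed
    ultimately show ?thesis by simp
  qed
  have dB: "((\<lambda>t. cross3 (nderiv 1 c t) (N t)) has_vector_derivative - torsion c t *\<^sub>R N t) (at t)" for t
  proof -
    have "cross3 (nderiv 1 c t) (cross3 (nderiv 1 c t) (N t)) = - N t"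
      using u11[of t] NN(2)[of t] by (simp add: Lagrange)
    moreover have "cross3 (nderiv 2 c t) (N t) = 0" by (simp add: N cross_mult_right)
    ultimately have "cross3 (nderiv 1 c t) (torsion c t *\<^sub>R cross3 (nderiv 1 c t) (N t) - \<kappa> t *\<^sub>R nderiv 1 c t)
        + cross3 (nderiv 2 c t) (N t) = - torsion c t *\<^sub>R N t"
      by (simp add: Cross3.right_diff_distrib cross_mult_right)
    then show ?thesis
      using has_vector_derivative_cross3[OF D1[of t] dN[of t]] by simp
  qed
  show ?thesis
    unfolding frenet_frame_def
  proof (intro allI conjI)
    fix t
    show "(nderiv 1 c has_vector_derivative curvature c t *\<^sub>R N t) (at t)"
      using D1[of t] kpos[of t] by (simp add: N flip: \<kappa>_def)
    show "(N has_vector_derivative torsion c t *\<^sub>R cross3 (nderiv 1 c t) (N t) - curvature c t *\<^sub>R nderiv 1 c t) (at t)"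
      using dN[of t] by (simp add: \<kappa>_def)
  qed (use u11 NN dB in auto)
qed

text \<open>Congruent frames give \<open>e' = Q c'\<close>, so \<open>e - Q c\<close> is constant.
  The sign of the torsion only decides whether the frame of \<open>c\<close> is flipped
  first.\<close>

lemma congruent_if_curvature_torsion:
  fixes c e :: "real \<Rightarrow> real^3"
  assumes dc: "\<And>i t. i < 3 \<Longrightarrow> nderiv i c differentiable (at t)"
    and de: "\<And>i t. i < 3 \<Longrightarrow> nderiv i e differentiable (at t)"
    and uc: "\<And>t. norm (nderiv 1 c t) = 1" and ue: "\<And>t. norm (nderiv 1 e t) = 1"
    and pos: "\<And>t. curvature e t > 0" and curv: "curvature e = curvature c"
    and tor: "torsion e = torsion c \<or> torsion e = (\<lambda>t. - torsion c t)"
  shows "\<exists>(Q :: real^3^3) (a :: real^3). orthogonal_matrix Q \<and> (\<forall>t. e t = Q *v c t + a)"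
proof -
  let ?N = "\<lambda>c t. inverse (curvature c t) *\<^sub>R nderiv 2 c t"
  have fc: "frenet_frame (curvature c) (torsion c) (nderiv 1 c) (?N c) (\<lambda>t. cross3 (nderiv 1 c t) (?N c t))"
    using dc uc pos unfolding curv by (rule unit_speed_frenet_frame)
  have fe: "frenet_frame (curvature c) (torsion e) (nderiv 1 e) (?N e) (\<lambda>t. cross3 (nderiv 1 e t) (?N e t))"
    unfolding curv[symmetric] using de ue pos by (rule unit_speed_frenet_frame)
  obtain Q :: "real^3^3" where Q: "orthogonal_matrix Q" "\<And>t. nderiv 1 e t = Q *v nderiv 1 c t"
  proof (cases "torsion e = torsion c")
    case True
    then show ?thesis using frenet_frames_congruent[OF fc fe[unfolded True]] that by metis
  next
    case False
    then have "torsion e = (\<lambda>t. - torsion c t)" using tor by simp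
    then show ?thesis
      using that frenet_frames_congruent[OF frenet_frame_flip[OF fc] fe[unfolded \<open>torsion e = _\<close>]] by blast
  qed
  have "((\<lambda>t. e t - Q *v c t) has_vector_derivative 0) (at t)" for t
  proof -
    have c: "(c has_vector_derivative nderiv 1 c t) (at t)" and e: "(e has_vector_derivative nderiv 1 e t) (at t)"
      using dc[of 0 t] de[of 0 t] by (simp_all add: vector_derivative_works nderiv.simps(2))
    have "((\<lambda>t. Q *v c t) has_vector_derivative Q *v nderiv 1 c t) (at t)"
      by (rule bounded_linear.has_vector_derivative[OF matrix_vector_mul_bounded_linear c])
    from has_vector_derivative_diff[OF e this] show ?thesis by (simp add: Q(2) del: One_nat_def)
  qed
  then have "\<exists>a. \<forall>t\<in>UNIV. e t - Q *v c t = a"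
    using has_vector_derivative_zero_constant[of UNIV "\<lambda>t. e t - Q *v c t"] by (metis convex_UNIV)
  then show ?thesis using Q(1) by (metis UNIV_I diff_eq_eq add.commute)
qed

section \<open>Torsion\<close>

text \<open>The numerator of the torsion, written as a triple product so that the derivative and
  limit rules for bilinear maps apply.\<close>

definition torsion_det :: "(real \<Rightarrow> real^3) \<Rightarrow> real \<Rightarrow> real" where
  "torsion_det \<gamma> t = cross3 (nderiv 1 \<gamma> t) (nderiv 2 \<gamma> t) \<bullet> nderiv 3 \<gamma> t"

definition torsion_det' :: "(real \<Rightarrow> real^3) \<Rightarrow> real \<Rightarrow> real" where
  "torsion_det' \<gamma> t = cross3 (nderiv 1 \<gamma> t) (nderiv 2 \<gamma> t) \<bullet> nderiv 4 \<gamma> t"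

lemma torsion_eq:
  "torsion \<gamma> t = torsion_det \<gamma> t / (norm (cross3 (nderiv 1 \<gamma> t) (nderiv 2 \<gamma> t)))\<^sup>2"
proof -
  have "x \<bullet> cross3 y z = cross3 x y \<bullet> z" for x y z by (simp add: cross3_simps)
  then show ?thesis by (simp add: torsion_def torsion_det_def dot_cross_det[symmetric])
qed

lemma Cr_has_vector_derivative:
  assumes "Cr r f"
  shows "0 < r \<Longrightarrow> (f has_vector_derivative nderiv 1 f t) (at t)"
    "1 < r \<Longrightarrow> (nderiv 1 f has_vector_derivative nderiv 2 f t) (at t)"
    "2 < r \<Longrightarrow> (nderiv 2 f has_vector_derivative nderiv 3 f t) (at t)"
    "3 < r \<Longrightarrow> (nderiv 3 f has_vector_derivative nderiv 4 f t) (at t)"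
  using Cr_nderiv_has[OF assms, of 0 t] Cr_nderiv_has[OF assms, of 1 t]
    Cr_nderiv_has[OF assms, of 2 t] Cr_nderiv_has[OF assms, of 3 t]
  by (simp_all add: numeral_eq_Suc)

text \<open>Of the three determinants in the product rule, two have a repeated entry and
  vanish.\<close>

lemma torsion_det_has_derivative:
  assumes "Cr r \<gamma>" "r \<ge> 4"
  shows "(torsion_det \<gamma> has_real_derivative torsion_det' \<gamma> t) (at t within S)"
proof -
  note d = Cr_has_vector_derivative[OF assms(1)]
  have "(torsion_det \<gamma> has_vector_derivative
      cross3 (nderiv 1 \<gamma> t) (nderiv 2 \<gamma> t) \<bullet> nderiv 4 \<gamma> t +
      (cross3 (nderiv 1 \<gamma> t) (nderiv 3 \<gamma> t) + cross3 (nderiv 2 \<gamma> t) (nderiv 2 \<gamma> t)) \<bullet> nderiv 3 \<gamma> t) (at t)"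
    unfolding torsion_det_def[abs_def] using assms(2)
    by (intro has_vector_derivative_inner has_vector_derivative_cross3 d) auto
  then show ?thesis
    by (simp add: has_real_derivative_iff_has_vector_derivative torsion_det'_def dot_cross_self
        has_vector_derivative_at_within)
qed

text \<open>The quotient rule. Where the numerator vanishes, the term with the derivative of the
  denominator drops out; this links simple zeros of the torsion to those of
  \<open>torsion_det\<close>. Continuity of \<open>d\<close> serves the later connectedness
  argument.\<close>

lemma torsion_has_derivative:
  assumes "Cr r \<gamma>" "r \<ge> 4" "\<And>t. cross3 (nderiv 1 \<gamma> t) (nderiv 2 \<gamma> t) \<noteq> 0"
  shows "\<exists>d. continuous_on UNIV d \<and> (\<forall>t. (torsion \<gamma> has_real_derivative d t) (at t)) \<and>
    (\<forall>t. torsion_det \<gamma> t = 0 \<longrightarrow>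
       d t = torsion_det' \<gamma> t / (norm (cross3 (nderiv 1 \<gamma> t) (nderiv 2 \<gamma> t)))\<^sup>2)"
proof -
  define w where "w t = cross3 (nderiv 1 \<gamma> t) (nderiv 2 \<gamma> t)" for t
  define w' where "w' t = cross3 (nderiv 1 \<gamma> t) (nderiv 3 \<gamma> t)" for t
  define d where "d t = (torsion_det' \<gamma> t * (w t \<bullet> w t) - torsion_det \<gamma> t * (2 * (w t \<bullet> w' t))) /
      ((w t \<bullet> w t) * (w t \<bullet> w t))" for t
  note dd = Cr_has_vector_derivative[OF assms(1)]
  have cont: "continuous_on UNIV (nderiv i \<gamma>)" if "i \<le> 4" for i
    using Cr_nderiv_continuous[OF assms(1)] that assms(2) by simp
  have wpos: "w t \<bullet> w t \<noteq> 0" for t using assms(3) by (simp add: w_def)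
  have "(w has_vector_derivative w' t) (at t)" for t
  proof -
    have "(w has_vector_derivative cross3 (nderiv 1 \<gamma> t) (nderiv 3 \<gamma> t)
        + cross3 (nderiv 2 \<gamma> t) (nderiv 2 \<gamma> t)) (at t)"
      unfolding w_def[abs_def] using assms(2) by (intro has_vector_derivative_cross3 dd) auto
    then show ?thesis by (simp add: w'_def)
  qed
  note dw = this
  have dww: "((\<lambda>t. w t \<bullet> w t) has_real_derivative 2 * (w t \<bullet> w' t)) (at t)" for t
    using has_vector_derivative_inner[OF dw dw, of t]
    by (simp add: has_real_derivative_iff_has_vector_derivative inner_commute)
  have eq: "torsion \<gamma> = (\<lambda>t. torsion_det \<gamma> t / (w t \<bullet> w t))"
    by (simp add: fun_eq_iff torsion_eq w_def power2_norm_eq_inner)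
  have "(torsion \<gamma> has_real_derivative d t) (at t)" for t
    unfolding eq d_def using wpos[of t]
    by (intro DERIV_divide torsion_det_has_derivative[OF assms(1,2)] dww)
  moreover have "continuous_on UNIV d"
    unfolding d_def w_def w'_def torsion_det_def torsion_det'_def
    using wpos by (intro continuous_intros continuous_on_cross cont) (auto simp: w_def)
  moreover have "d t = torsion_det' \<gamma> t / (norm (cross3 (nderiv 1 \<gamma> t) (nderiv 2 \<gamma> t)))\<^sup>2"
    if "torsion_det \<gamma> t = 0" for t
    using that wpos[of t] by (simp add: d_def w_def power2_norm_eq_inner)
  ultimately show ?thesis by blast
qed

text \<open>Free of division, so the condition is open in the 4-jet on compact sets; relative to a
  set \<open>I\<close>, so that zeros can be made simple one arc at a time.\<close>

definition simple_zeros_on :: "real set \<Rightarrow> (real \<Rightarrow> real^3) \<Rightarrow> bool" where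
  "simple_zeros_on I \<gamma> \<longleftrightarrow> (\<forall>t\<in>I. torsion_det \<gamma> t \<noteq> 0 \<or> torsion_det' \<gamma> t \<noteq> 0)"

lemma EmbD:
  assumes "\<gamma> \<in> Emb r"
  shows "\<gamma> \<in> Cr_curves r" "Cr r \<gamma>" "periodic 1 \<gamma>" "nderiv 1 \<gamma> t \<noteq> 0" "inj_on \<gamma> {0..<1}"
    "cross3 (nderiv 1 \<gamma> t) (nderiv 2 \<gamma> t) \<noteq> 0"
  using assms by (auto simp: Emb_def Cr_curves_def)

lemma periodic_1_frac:
  assumes "periodic 1 f"
  shows "f t = f (frac t)"
proof -
  interpret periodic_fun_simple' f
    using assms by unfold_locales (simp add: periodic_def)
  show ?thesis using plus_of_int[of "frac t" "\<lfloor>t\<rfloor>"] by (simp add: frac_def)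
qed

text \<open>The positive denominator affects neither the zeros nor their simplicity, and periodicity
  reduces the line to one compact period.\<close>

lemma Gen_iff:
  assumes "r \<ge> 4"
  shows "\<gamma> \<in> Gen r \<longleftrightarrow> \<gamma> \<in> Emb r \<and> simple_zeros_on {0..1} \<gamma>"
proof (cases "\<gamma> \<in> Emb r")
  case True
  note E = EmbD[OF True]
  obtain d where d: "\<And>t. (torsion \<gamma> has_real_derivative d t) (at t)"
    "\<And>t. torsion_det \<gamma> t = 0 \<Longrightarrow>
       d t = torsion_det' \<gamma> t / (norm (cross3 (nderiv 1 \<gamma> t) (nderiv 2 \<gamma> t)))\<^sup>2"
    using torsion_has_derivative[OF E(2) assms E(6)] by metis
  have "torsion \<gamma> t = 0 \<longleftrightarrow> torsion_det \<gamma> t = 0" for t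
    using E(6) by (simp add: torsion_eq)
  then have "only_simple_zeros (torsion \<gamma>) \<longleftrightarrow> simple_zeros_on UNIV \<gamma>"
    using d(2) E(6) by (auto simp: only_simple_zeros_def simple_zeros_on_def DERIV_imp_deriv[OF d(1)])
  also have "\<dots> \<longleftrightarrow> simple_zeros_on {0..1} \<gamma>"
  proof -
    have "nderiv i \<gamma> (frac t) = nderiv i \<gamma> t" if "i \<le> 4" for i t
      using that assms by (intro periodic_1_frac[symmetric] periodic_nderiv[OF E(2,3)]) auto
    then have "torsion_det \<gamma> t = torsion_det \<gamma> (frac t)" "torsion_det' \<gamma> t = torsion_det' \<gamma> (frac t)" for t
      by (simp_all add: torsion_det_def torsion_det'_def)
    moreover have "frac t \<in> {0..1}" for t :: real using frac_lt_1[of t] by simp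
    ultimately show ?thesis by (metis UNIV_I simple_zeros_on_def)
  qed
  finally show ?thesis using True by (simp add: Gen_def)
qed (simp add: Gen_def)

section \<open>Convergence of jets\<close>

lemma Cr_dist_ge:
  assumes "\<gamma> \<in> Cr_curves r" "\<delta> \<in> Cr_curves r" "i \<le> r"
  shows "norm (nderiv i \<gamma> t - nderiv i \<delta> t) \<le> Cr_dist r \<gamma> \<delta>"
  using Cr_dist_le_iff[OF assms(1,2), of "Cr_dist r \<gamma> \<delta>"] assms(3) by blast

text \<open>\<open>Cr_dist\<close> controls derivatives uniformly in the parameter, so the
  evaluation point may move along with the curve.\<close>

lemma tendsto_nderiv:
  assumes "\<gamma> \<in> Cr_curves r" "i \<le> r"
    and \<delta>: "eventually (\<lambda>n. \<delta> n \<in> Cr_curves r) F" "((\<lambda>n. Cr_dist r \<gamma> (\<delta> n)) \<longlongrightarrow> 0) F"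
    and x: "(x \<longlongrightarrow> t) F"
  shows "((\<lambda>n. nderiv i (\<delta> n) (x n)) \<longlongrightarrow> nderiv i \<gamma> t) F"
proof -
  have "isCont (nderiv i \<gamma>) t"
    using Cr_nderiv_continuous[of r \<gamma> i] assms(1,2)
    by (simp add: Cr_curves_def continuous_on_eq_continuous_at)
  then have "((\<lambda>n. nderiv i \<gamma> (x n)) \<longlongrightarrow> nderiv i \<gamma> t) F" using x by (rule isCont_tendsto_compose)
  moreover have "((\<lambda>n. nderiv i \<gamma> (x n) - nderiv i (\<delta> n) (x n)) \<longlongrightarrow> 0) F"
  proof (rule Lim_null_comparison[OF _ \<delta>(2)])
    show "\<forall>\<^sub>F n in F. norm (nderiv i \<gamma> (x n) - nderiv i (\<delta> n) (x n)) \<le> Cr_dist r \<gamma> (\<delta> n)"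
      using \<delta>(1) by eventually_elim (use assms in \<open>auto intro: Cr_dist_ge\<close>)
  qed
  ultimately show ?thesis by (rule Lim_transform2)
qed

text \<open>The assumption \<open>closed\<close> says that \<open>P\<close> is a closed condition on \<open>r\<close>-jets.\<close>

lemma jet_condition_open:
  assumes \<gamma>: "\<gamma> \<in> Cr_curves r" and "compact K" and not: "\<And>t. t \<in> K \<Longrightarrow> \<not> P \<gamma> t"
    and closed: "\<And>\<delta> x t. t \<in> K \<Longrightarrow> x \<longlonglongrightarrow> t \<Longrightarrow>
      (\<And>i. i \<le> r \<Longrightarrow> (\<lambda>n. nderiv i (\<delta> n) (x n)) \<longlonglongrightarrow> nderiv i \<gamma> t) \<Longrightarrow>
      (\<And>n. \<delta> n \<in> Cr_curves r) \<Longrightarrow> (\<And>n. P (\<delta> n) (x n :: real)) \<Longrightarrow> P \<gamma> t"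
  shows "\<exists>\<epsilon>>0. \<forall>\<delta>\<in>Cr_curves r. Cr_dist r \<gamma> \<delta> < \<epsilon> \<longrightarrow> (\<forall>t\<in>K. \<forall>s. \<bar>s - t\<bar> \<le> \<epsilon> \<longrightarrow> \<not> P \<delta> s)"
proof (rule ccontr)
  assume neg: "\<not> ?thesis"
  \<comment> \<open>Counterexamples at scale \<open>1 / (n + 1)\<close>; along a subsequence
    \<open>t\<close>, and with it \<open>s\<close>, converges to a point \<open>l\<close> of
    \<open>K\<close> where the limit curve would satisfy \<open>P\<close>.\<close>
  have "\<exists>\<delta> s t. \<delta> \<in> Cr_curves r \<and> Cr_dist r \<gamma> \<delta> < inverse (real (Suc n)) \<and> t \<in> K \<and>
      \<bar>s - t\<bar> \<le> inverse (real (Suc n)) \<and> P \<delta> s" for n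
    using neg[unfolded not_ex, rule_format, of "inverse (real (Suc n))"] by auto
  then obtain \<delta> s t where *: "\<And>n. \<delta> n \<in> Cr_curves r" "\<And>n. Cr_dist r \<gamma> (\<delta> n) < inverse (real (Suc n))"
    "\<And>n. t n \<in> K" "\<And>n. \<bar>s n - t n\<bar> \<le> inverse (real (Suc n))" "\<And>n. P (\<delta> n) (s n)"
    by metis
  obtain l k where l: "l \<in> K" "strict_mono k" "(t \<circ> k) \<longlonglongrightarrow> l"
    using \<open>compact K\<close> *(3) unfolding compact_def by metis
  have null: "(\<lambda>n. inverse (real (Suc (k n)))) \<longlonglongrightarrow> 0"
    using LIMSEQ_subseq_LIMSEQ[OF LIMSEQ_inverse_real_of_nat l(2)] by (simp add: o_def)
  have "(\<lambda>n. t (k n) - s (k n)) \<longlonglongrightarrow> 0"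
    by (rule Lim_null_comparison[OF _ null]) (use *(4) in \<open>simp add: abs_minus_commute\<close>)
  with l(3) have s: "(\<lambda>n. s (k n)) \<longlonglongrightarrow> l" by (auto simp: o_def intro: Lim_transform2)
  interpret Metric_space "Cr_curves r" "Cr_dist r" by (rule Metric_space_Cr)
  have "(\<lambda>n. Cr_dist r \<gamma> (\<delta> (k n))) \<longlonglongrightarrow> 0"
    by (rule Lim_null_comparison[OF _ null]) (use *(2) in \<open>simp add: less_imp_le\<close>)
  then have "(\<lambda>n. nderiv i (\<delta> (k n)) (s (k n))) \<longlonglongrightarrow> nderiv i \<gamma> l" if "i \<le> r" for i
    using *(1) by (intro tendsto_nderiv[OF \<gamma> that] s) auto
  then have "P \<gamma> l" using *(1,5) l(1) s by (intro closed[of l "\<lambda>n. s (k n)" "\<lambda>n. \<delta> (k n)"]) auto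
  then show False using not l(1) by blast
qed

lemma tendsto_cross3:
  assumes "(f \<longlongrightarrow> a) F" "(g \<longlongrightarrow> b) F"
  shows "((\<lambda>x. cross3 (f x) (g x)) \<longlongrightarrow> cross3 a b) F"
  using bounded_bilinear.tendsto[OF bilinear_cross[unfolded bilinear_conv_bounded_bilinear] assms] .

text \<open>The failure condition consists of two equations between continuous functions of the
  4-jet, hence is closed; \<open>r \<ge> 4\<close> lets these jets converge.\<close>

lemma simple_zeros_on_open:
  assumes "\<gamma> \<in> Cr_curves r" "r \<ge> 4" "compact K" "simple_zeros_on K \<gamma>"
  shows "\<exists>\<epsilon>>0. \<forall>\<delta>\<in>Cr_curves r. Cr_dist r \<gamma> \<delta> < \<epsilon> \<longrightarrow> simple_zeros_on K \<delta>"
proof -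
  have "\<exists>\<epsilon>>0. \<forall>\<delta>\<in>Cr_curves r. Cr_dist r \<gamma> \<delta> < \<epsilon> \<longrightarrow>
      (\<forall>t\<in>K. \<forall>s. \<bar>s - t\<bar> \<le> \<epsilon> \<longrightarrow> \<not> (torsion_det \<delta> s = 0 \<and> torsion_det' \<delta> s = 0))"
  proof (rule jet_condition_open[OF assms(1,3)])
    show "\<not> (torsion_det \<gamma> t = 0 \<and> torsion_det' \<gamma> t = 0)" if "t \<in> K" for t
      using assms(4) that by (auto simp: simple_zeros_on_def)
    fix \<delta> x t
    assume lim: "\<And>i. i \<le> r \<Longrightarrow> (\<lambda>n. nderiv i (\<delta> n) (x n)) \<longlonglongrightarrow> nderiv i \<gamma> t"
      and 0: "\<And>n. torsion_det (\<delta> n) (x n) = 0 \<and> torsion_det' (\<delta> n) (x n) = 0"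
    have "(\<lambda>n. torsion_det (\<delta> n) (x n)) \<longlonglongrightarrow> torsion_det \<gamma> t"
      "(\<lambda>n. torsion_det' (\<delta> n) (x n)) \<longlonglongrightarrow> torsion_det' \<gamma> t"
      unfolding torsion_det_def torsion_det'_def using assms(2)
      by (intro tendsto_inner tendsto_cross3 lim; simp)+
    then show "torsion_det \<gamma> t = 0 \<and> torsion_det' \<gamma> t = 0"
      using 0 by (auto simp: LIMSEQ_const_iff)
  qed
  then obtain \<epsilon> where "\<epsilon> > 0" "\<And>\<delta> t. \<delta> \<in> Cr_curves r \<Longrightarrow> Cr_dist r \<gamma> \<delta> < \<epsilon> \<Longrightarrow> t \<in> K \<Longrightarrow>
      \<not> (torsion_det \<delta> t = 0 \<and> torsion_det' \<delta> t = 0)"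
    by (metis abs_zero diff_self less_imp_le)
  then show ?thesis unfolding simple_zeros_on_def by metis
qed

section \<open>Openness of the embedding conditions\<close>

text \<open>Between the two parameters of a double point, Rolle's theorem makes the velocity of
  \<open>\<delta> n\<close> orthogonal to the fixed vector \<open>nderiv 1 \<gamma> l\<close>. In
  the limit that vector is orthogonal to itself.\<close>

lemma no_collapsing_double_points:
  assumes \<gamma>: "\<gamma> \<in> Cr_curves r" "r \<ge> 1" "nderiv 1 \<gamma> l \<noteq> 0"
    and \<delta>: "\<And>n. \<delta> n \<in> Cr_curves r" "(\<lambda>n. Cr_dist r \<gamma> (\<delta> n)) \<longlonglongrightarrow> 0"
    and xy: "x \<longlonglongrightarrow> l" "y \<longlonglongrightarrow> l" "\<And>n. x n < y n" "\<And>n. \<delta> n (x n) = \<delta> n (y n)"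
  shows False
proof -
  have "\<exists>z. x n < z \<and> z < y n \<and> nderiv 1 (\<delta> n) z \<bullet> nderiv 1 \<gamma> l = 0" for n
  proof -
    \<comment> \<open>Rolle needs a scalar function, hence the projection onto the limiting
      velocity.\<close>
    let ?f = "\<lambda>t. \<delta> n t \<bullet> nderiv 1 \<gamma> l"
    have d: "(?f has_real_derivative nderiv 1 (\<delta> n) t \<bullet> nderiv 1 \<gamma> l) (at t)" for t
      using has_vector_derivative_inner[OF Cr_has_vector_derivative(1)[of r "\<delta> n" t]
          has_vector_derivative_const[of "nderiv 1 \<gamma> l"]] \<delta>(1)[of n] \<gamma>(2)
      by (simp add: Cr_curves_def has_real_derivative_iff_has_vector_derivative)
    have "\<exists>z. x n < z \<and> z < y n \<and> (\<lambda>h. (nderiv 1 (\<delta> n) z \<bullet> nderiv 1 \<gamma> l) * h) = (\<lambda>h. 0)"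
    proof (rule Rolle_deriv[of "x n" "y n" ?f "\<lambda>t h. (nderiv 1 (\<delta> n) t \<bullet> nderiv 1 \<gamma> l) * h"])
      show "continuous_on {x n..y n} ?f"
        using d by (meson DERIV_isCont continuous_at_imp_continuous_on)
      show "(?f has_derivative (\<lambda>h. (nderiv 1 (\<delta> n) t \<bullet> nderiv 1 \<gamma> l) * h)) (at t)" for t
        using d by (simp add: has_field_derivative_def)
    qed (use xy in auto)
    then show ?thesis by (metis mult.right_neutral)
  qed
  then obtain z where z: "\<And>n. x n < z n" "\<And>n. z n < y n"
    "\<And>n. nderiv 1 (\<delta> n) (z n) \<bullet> nderiv 1 \<gamma> l = 0" by metis
  have "z \<longlonglongrightarrow> l"
    by (rule tendsto_sandwich[OF _ _ xy(1,2)]) (use z in \<open>auto simp: less_imp_le\<close>)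
  then have "(\<lambda>n. nderiv 1 (\<delta> n) (z n)) \<longlonglongrightarrow> nderiv 1 \<gamma> l"
    using \<delta> \<gamma>(2) by (intro tendsto_nderiv[OF \<gamma>(1)]) auto
  then have "(\<lambda>n. nderiv 1 (\<delta> n) (z n) \<bullet> nderiv 1 \<gamma> l) \<longlonglongrightarrow> nderiv 1 \<gamma> l \<bullet> nderiv 1 \<gamma> l"
    by (intro tendsto_intros)
  then show False using z(3) \<gamma>(3) by (simp add: LIMSEQ_const_iff)
qed

text \<open>Double points of curves approaching \<open>\<gamma>\<close> subconverge to a pair
  \<open>(a, b)\<close> with \<open>\<gamma> a = \<gamma> b\<close>. Injectivity of
  \<open>\<gamma>\<close> leaves \<open>a = b\<close> or the seam \<open>a = 0\<close>,
  \<open>b = 1\<close>; in either case the two points collapse on the circle.\<close>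

lemma injective_open:
  assumes "\<gamma> \<in> Emb r" "r \<ge> 1"
  shows "\<exists>\<epsilon>>0. \<forall>\<delta>\<in>Cr_curves r. Cr_dist r \<gamma> \<delta> < \<epsilon> \<longrightarrow> inj_on \<delta> {0..<1}"
proof (rule ccontr)
  note E = EmbD[OF assms(1)]
  assume neg: "\<not> ?thesis"
  have "\<exists>\<delta> x y. \<delta> \<in> Cr_curves r \<and> Cr_dist r \<gamma> \<delta> < inverse (real (Suc n)) \<and>
      0 \<le> x \<and> x < y \<and> y < 1 \<and> \<delta> x = \<delta> y" for n
  proof -
    obtain \<delta> x y where "\<delta> \<in> Cr_curves r" "Cr_dist r \<gamma> \<delta> < inverse (real (Suc n))"
      "x \<in> {0..<1}" "y \<in> {0..<1}" "\<delta> x = \<delta> y" "x \<noteq> y"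
      using neg[unfolded not_ex, rule_format, of "inverse (real (Suc n))"] by (auto simp: inj_on_def)
    then show ?thesis by (cases x y rule: linorder_cases) force+
  qed
  then obtain \<delta> x y where *: "\<And>n. \<delta> n \<in> Cr_curves r" "\<And>n. Cr_dist r \<gamma> (\<delta> n) < inverse (real (Suc n))"
    "\<And>n. 0 \<le> x n" "\<And>n. x n < y n" "\<And>n. y n < 1" "\<And>n. \<delta> n (x n) = \<delta> n (y n)"
    by metis
  have "(x n, y n) \<in> {0..1} \<times> {0..1}" for n
    using *(3-5)[of n] by simp
  moreover have "compact ({0..1::real} \<times> {0..1::real})" by (intro compact_Times) auto
  ultimately obtain l k where l: "l \<in> {0..1} \<times> {0..1}" "strict_mono (k::nat\<Rightarrow>nat)"
      "((\<lambda>n. (x n, y n)) \<circ> k) \<longlonglongrightarrow> l"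
    unfolding compact_def by meson
  obtain a b where ab: "l = (a, b)" by (cases l)
  have lim: "(\<lambda>n. x (k n)) \<longlonglongrightarrow> a" "(\<lambda>n. y (k n)) \<longlonglongrightarrow> b"
    using tendsto_fst[OF l(3)] tendsto_snd[OF l(3)] by (simp_all add: ab o_def)
  have null: "(\<lambda>n. inverse (real (Suc (k n)))) \<longlonglongrightarrow> 0"
    using LIMSEQ_subseq_LIMSEQ[OF LIMSEQ_inverse_real_of_nat l(2)] by (simp add: o_def)
  interpret Metric_space "Cr_curves r" "Cr_dist r" by (rule Metric_space_Cr)
  have dlim: "(\<lambda>n. Cr_dist r \<gamma> (\<delta> (k n))) \<longlonglongrightarrow> 0"
    by (rule Lim_null_comparison[OF _ null]) (use *(2) in \<open>simp add: less_imp_le\<close>)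
  have ev: "(\<lambda>n. nderiv 0 (\<delta> (k n)) (z (k n))) \<longlonglongrightarrow> nderiv 0 \<gamma> c"
    if "(\<lambda>n. z (k n)) \<longlonglongrightarrow> c" for z c
    using *(1) by (intro tendsto_nderiv[OF E(1)] that dlim) auto
  have "\<gamma> a = \<gamma> b"
    using LIMSEQ_unique[OF ev[OF lim(1)]] ev[OF lim(2)] *(6) by simp
  have "a \<le> b" using lim *(4) by (intro LIMSEQ_le[OF lim]) (auto intro: less_imp_le)
  show False
  proof (cases "a = b")
    case True
    then show False
      using no_collapsing_double_points[OF E(1) assms(2) E(4) *(1) dlim lim(1)] lim(2) *(4,6) by auto
  next
    case False
    have bd: "0 \<le> a" "b \<le> 1" using l(1) by (auto simp: ab)
    have "b = 1"
    proof (rule ccontr)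
      assume "b \<noteq> 1"
      then have "a \<in> {0..<1}" "b \<in> {0..<1}" using bd \<open>a \<le> b\<close> False by auto
      then show False using E(5) \<open>\<gamma> a = \<gamma> b\<close> False by (auto simp: inj_on_def)
    qed
    have "\<gamma> 1 = \<gamma> 0" using E(3)[unfolded periodic_def, rule_format, of 0] by simp
    have "a = 0"
    proof (rule inj_onD[OF E(5)])
      show "\<gamma> a = \<gamma> 0" using \<open>\<gamma> a = \<gamma> b\<close> \<open>b = 1\<close> \<open>\<gamma> 1 = \<gamma> 0\<close> by simp
      show "a \<in> {0..<1}" using bd \<open>a \<le> b\<close> False \<open>b = 1\<close> by auto
    qed simp
    \<comment> \<open>Moving \<open>y\<close> back by one period places it below \<open>x\<close>,
      with both tending to 0, so the two sequences exchange roles.\<close>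
    have "(\<lambda>n. y (k n) - 1) \<longlonglongrightarrow> 0"
      using tendsto_diff[OF lim(2) tendsto_const[of 1]] \<open>b = 1\<close> by simp
    moreover have "\<delta> (k n) (y (k n) - 1) = \<delta> (k n) (x (k n))" for n
      using *(1)[of "k n"] *(6)[of "k n"] spec[of "\<lambda>t. \<delta> (k n) (t + 1) = \<delta> (k n) t" "y (k n) - 1"]
      by (simp add: Cr_curves_def periodic_def)
    moreover have "y (k n) - 1 < x (k n)" for n using *(3,5)[of "k n"] by simp
    ultimately show False
      using no_collapsing_double_points[OF E(1) assms(2) E(4) *(1) dlim, of "\<lambda>n. y (k n) - 1" 0 "\<lambda>n. x (k n)"]
        lim(1) \<open>a = 0\<close> by blast
  qed
qed

text \<open>Injectivity persists by \<open>injective_open\<close>, the nonzero cross product by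
  compactness of a period; the nonzero velocity follows from the latter.\<close>

lemma Emb_open:
  assumes "\<gamma> \<in> Emb r" "r \<ge> 2"
  shows "\<exists>\<epsilon>>0. \<forall>\<delta>\<in>Cr_curves r. Cr_dist r \<gamma> \<delta> < \<epsilon> \<longrightarrow> \<delta> \<in> Emb r"
proof -
  note E = EmbD[OF assms(1)]
  let ?P = "\<lambda>\<delta> s. cross3 (nderiv 1 \<delta> s) (nderiv 2 \<delta> s) = 0"
  have "\<exists>\<epsilon>>0. \<forall>\<delta>\<in>Cr_curves r. Cr_dist r \<gamma> \<delta> < \<epsilon> \<longrightarrow>
      (\<forall>t\<in>{0..1}. \<forall>s. \<bar>s - t\<bar> \<le> \<epsilon> \<longrightarrow> \<not> ?P \<delta> s)"
  proof (rule jet_condition_open[OF E(1)])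
    fix \<delta> x t
    assume lim: "\<And>i. i \<le> r \<Longrightarrow> (\<lambda>n. nderiv i (\<delta> n) (x n)) \<longlonglongrightarrow> nderiv i \<gamma> t" and 0: "\<And>n. ?P (\<delta> n) (x n)"
    have "(\<lambda>n. cross3 (nderiv 1 (\<delta> n) (x n)) (nderiv 2 (\<delta> n) (x n))) \<longlonglongrightarrow>
        cross3 (nderiv 1 \<gamma> t) (nderiv 2 \<gamma> t)"
      using assms(2) by (intro tendsto_cross3 lim) auto
    then show "?P \<gamma> t" using 0 by (simp add: LIMSEQ_const_iff)
  qed (use E(6) in auto)
  then obtain \<epsilon>1 where 1: "\<epsilon>1 > 0" "\<And>\<delta> t. \<delta> \<in> Cr_curves r \<Longrightarrow> Cr_dist r \<gamma> \<delta> < \<epsilon>1 \<Longrightarrow> t \<in> {0..1} \<Longrightarrow> \<not> ?P \<delta> t"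
    by (metis abs_zero diff_self less_imp_le)
  obtain \<epsilon>2 where 2: "\<epsilon>2 > 0" "\<And>\<delta>. \<delta> \<in> Cr_curves r \<Longrightarrow> Cr_dist r \<gamma> \<delta> < \<epsilon>2 \<Longrightarrow> inj_on \<delta> {0..<1}"
    using injective_open[OF assms(1)] assms(2) by auto
  have "\<delta> \<in> Emb r" if d: "\<delta> \<in> Cr_curves r" "Cr_dist r \<gamma> \<delta> < min \<epsilon>1 \<epsilon>2" for \<delta>
  proof -
    have "\<not> ?P \<delta> t" for t
    proof -
      have "nderiv i \<delta> t = nderiv i \<delta> (frac t)" if "i \<le> 2" for i
        using that assms(2) d(1) by (intro periodic_1_frac periodic_nderiv[of r]) (auto simp: Cr_curves_def)
      moreover have "\<not> ?P \<delta> (frac t)" using 1(2)[OF d(1)] d(2) frac_lt_1[of t] by auto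
      ultimately show ?thesis by simp
    qed
    moreover have "nderiv 1 \<delta> t \<noteq> 0" for t using calculation[of t] by auto
    ultimately show ?thesis using 2(2)[OF d(1)] d by (simp add: Emb_def)
  qed
  then show ?thesis using 1(1) 2(1) by (intro exI[of _ "min \<epsilon>1 \<epsilon>2"]) auto
qed

section \<open>Perturbation to simple zeros\<close>

text \<open>By Sard the critical values form a null set, which cannot contain the interval from 0 to
  \<open>e\<close>. \<open>baby_Sard\<close> concerns maps between Cartesian spaces, hence the
  passage through \<open>real^1\<close>.\<close>

lemma regular_value_near_0:
  fixes q :: "real \<Rightarrow> real"
  assumes q: "\<And>t. t \<in> S \<Longrightarrow> (q has_real_derivative q' t) (at t within S)" and "e > 0"
  obtains c where "0 < c" "c < e" "\<And>t. t \<in> S \<Longrightarrow> q t = c \<Longrightarrow> q' t \<noteq> 0"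
proof -
  define Z where "Z = {x :: real^1. x $ 1 \<in> S \<and> q' (x $ 1) = 0}"
  define f :: "real^1 \<Rightarrow> real^1" where "f x = q (x $ 1) *\<^sub>R axis 1 1" for x
  have "negligible (f ` Z)"
  proof (rule baby_Sard[where f' = "\<lambda>_ h. 0"])
    fix x assume x: "x \<in> Z"
    have "(q has_derivative (\<lambda>h. 0)) (at (x $ 1) within S)"
      using q[of "x $ 1"] x by (simp add: Z_def has_field_derivative_def lambda_zero)
    then have "(q has_derivative (\<lambda>h. 0)) (at (x $ 1) within (\<lambda>x. x $ 1) ` Z)"
      by (rule has_derivative_subset) (auto simp: Z_def)
    moreover have "((\<lambda>x. x $ 1) has_derivative (\<lambda>h. h $ 1)) (at x within Z)"
      by (rule bounded_linear_imp_has_derivative) (rule bounded_linear_vec_nth)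
    ultimately have "((\<lambda>x. q (x $ 1)) has_derivative (\<lambda>h. 0)) (at x within Z)"
      using diff_chain_within[of "\<lambda>x. x $ 1"] by (fastforce simp: o_def)
    then show "(f has_derivative (\<lambda>h. 0)) (at x within Z)"
      unfolding f_def by (auto intro: has_derivative_scaleR_left[THEN has_derivative_eq_rhs])
    have "matrix (\<lambda>h::real^1. 0 :: real^1) = 0" by (simp add: matrix_def vec_eq_iff)
    then show "rank (matrix (\<lambda>h::real^1. 0 :: real^1)) < CARD(1)" by simp
  qed simp
  moreover have "\<not> negligible (box (0::real^1) (e *\<^sub>R 1))"
    using \<open>e > 0\<close> by (intro open_not_negligible) (auto simp: box_ne_empty Basis_vec_def inner_axis open_box)
  ultimately obtain y where y: "y \<in> box (0::real^1) (e *\<^sub>R 1)" "y \<notin> f ` Z"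
    using negligible_subset by blast
  have y1: "0 < y $ 1" "y $ 1 < e" using y(1) by (auto simp: mem_box_cart)
  have "q' t \<noteq> 0" if t: "t \<in> S" "q t = y $ 1" for t
  proof
    assume "q' t = 0"
    then have "vec t \<in> Z" using t by (simp add: Z_def)
    moreover have "f (vec t) = y" using t by (simp add: f_def vec_eq_iff axis_def)
    ultimately show False using y(2) by blast
  qed
  then show ?thesis using that y1 by blast
qed

section \<open>Trigonometric perturbations in a fixed direction\<close>

text \<open>By uniqueness of derivatives, a proposed chain of successive derivatives is the true
  one; this avoids computing \<open>nderiv\<close> recursively.\<close>

lemma Cr_tower:
  assumes F: "\<And>i t. i < r \<Longrightarrow> (F i has_vector_derivative F (Suc i) t) (at t)"
    and c: "continuous_on UNIV (F r)"
  shows "Cr r (F 0)" "i \<le> r \<Longrightarrow> nderiv i (F 0) = F i"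
proof -
  have n: "nderiv i (F 0) = F i" if "i \<le> r" for i
    using that
  proof (induction i)
    case (Suc i)
    then show ?case using vector_derivative_at[OF F[of i]] by (simp add: nderiv.simps(2))
  qed simp
  then show "i \<le> r \<Longrightarrow> nderiv i (F 0) = F i" .
  show "Cr r (F 0)"
    unfolding Cr_def using n c F by (auto intro: differentiableI_vector)
qed

text \<open>
  The \<open>i\<close>-th derivative of \<open>\<lambda>t. sin (2 * pi * (t - a)) - sin (4 * pi * (t - a)) / 2\<close>, whose 2-jet
  vanishes at \<open>a\<close> while its third derivative does not.
\<close>

definition bump :: "real \<Rightarrow> nat \<Rightarrow> real \<Rightarrow> real" where
  "bump a i t = (2 * pi) ^ i * sin (2 * pi * (t - a) + i * (pi / 2))
              - (4 * pi) ^ i / 2 * sin (4 * pi * (t - a) + i * (pi / 2))"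

text \<open>Differentiating a sine multiplies by its frequency and advances the phase by
  \<open>pi / 2\<close>, so one formula serves all orders.\<close>

lemma bump_has_derivative: "(bump a i has_real_derivative bump a (Suc i) t) (at t)"
proof -
  have s: "sin (x + (1 + real i) * (pi / 2)) = cos (x + i * (pi / 2))" for x
    using sin_add[of "x + i * (pi / 2)" "pi / 2"] by (simp add: algebra_simps add_divide_distrib)
  show ?thesis
    unfolding bump_def[abs_def] of_nat_Suc s
    by (auto intro!: derivative_eq_intros simp: algebra_simps)
qed

text \<open>The weights 1 and -1/2 cancel the first derivatives, as
  \<open>2 pi - 4 pi / 2 = 0\<close>; the second ones vanish as sines of multiples of
  \<open>pi\<close>. The third is \<open>-(2 pi)^3 + (4 pi)^3 / 2\<close>.\<close>

lemma bump_center: "bump a 1 a = 0" "bump a 2 a = 0" "bump a 3 a = 24 * pi ^ 3"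
proof -
  have "sin (3 * (pi / 2)) = -1"
    using sin_add[of pi "pi / 2"] by (simp add: field_simps)
  then show "bump a 1 a = 0" "bump a 2 a = 0" "bump a 3 a = 24 * pi ^ 3"
    by (simp_all add: bump_def power_mult_distrib)
qed

lemma bump_bound:
  assumes "i \<le> r"
  shows "\<bar>bump a i t\<bar> \<le> 2 * (4 * pi) ^ r"
proof -
  have "\<bar>bump a i t\<bar> \<le> (2 * pi) ^ i * 1 + (4 * pi) ^ i / 2 * 1"
    unfolding bump_def
    by (rule order_trans[OF abs_triangle_ineq4]) (intro add_mono, auto simp: abs_mult intro!: mult_left_le)
  also have "(2 * pi) ^ i \<le> (4 * pi) ^ i" by (intro power_mono) auto
  also have "(4 * pi) ^ i \<le> (4 * pi) ^ r"
    using pi_ge_two by (intro power_increasing assms) auto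
  finally show ?thesis by (simp add: field_simps)
qed

lemma bump_periodic: "bump a i (t + 1) = bump a i t"
proof -
  have "sin (2 * pi * (t + 1 - a) + i * (pi / 2)) = sin (2 * pi * (t - a) + i * (pi / 2))"
    using sin_periodic[of "2 * pi * (t - a) + i * (pi / 2)"] by (simp add: algebra_simps)
  moreover have "sin (4 * pi * (t + 1 - a) + i * (pi / 2)) = sin (4 * pi * (t - a) + i * (pi / 2))"
    using sin_periodic[of "4 * pi * (t - a) + i * (pi / 2)"]
      sin_periodic[of "4 * pi * (t - a) + i * (pi / 2) + 2 * pi"] by (simp add: algebra_simps)
  ultimately show ?thesis by (simp add: bump_def)
qed

definition perturb :: "real \<Rightarrow> real^3 \<Rightarrow> real \<Rightarrow> (real \<Rightarrow> real^3) \<Rightarrow> real \<Rightarrow> real^3" where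
  "perturb a v c \<gamma> t = \<gamma> t + (c * bump a 0 t) *\<^sub>R v"

lemma perturb:
  assumes "\<gamma> \<in> Cr_curves r"
  shows "perturb a v c \<gamma> \<in> Cr_curves r"
    "i \<le> r \<Longrightarrow> nderiv i (perturb a v c \<gamma>) t = nderiv i \<gamma> t + (c * bump a i t) *\<^sub>R v"
proof -
  have cr: "Cr r \<gamma>" "periodic 1 \<gamma>" using assms by (auto simp: Cr_curves_def)
  define F where "F i t = nderiv i \<gamma> t + (c * bump a i t) *\<^sub>R v" for i t
  have 1: "(F i has_vector_derivative F (Suc i) t) (at t)" if "i < r" for i t
  proof -
    have "((\<lambda>t. (c * bump a i t) *\<^sub>R v) has_vector_derivative
        (c * bump a i t) *\<^sub>R 0 + (c * bump a (Suc i) t) *\<^sub>R v) (at t)"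
      by (intro has_vector_derivative_scaleR DERIV_cmult bump_has_derivative has_vector_derivative_const)
    then show ?thesis
      unfolding F_def using Cr_nderiv_has[OF cr(1) that, of t] by (auto intro: has_vector_derivative_add)
  qed
  have 2: "continuous_on UNIV (F r)"
    unfolding F_def bump_def using Cr_nderiv_continuous[OF cr(1), of r] by (intro continuous_intros) auto
  have "F 0 = perturb a v c \<gamma>" by (auto simp: F_def perturb_def)
  note tower = Cr_tower[of r F, OF 1 2, unfolded this]
  show "i \<le> r \<Longrightarrow> nderiv i (perturb a v c \<gamma>) t = nderiv i \<gamma> t + (c * bump a i t) *\<^sub>R v"
    using tower(2) by (simp add: F_def)
  show "perturb a v c \<gamma> \<in> Cr_curves r"
    using tower(1) cr(2) by (simp add: Cr_curves_def periodic_def) (simp add: perturb_def bump_periodic)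
qed

lemma perturb_dist:
  assumes "\<gamma> \<in> Cr_curves r" "c \<ge> 0"
  shows "Cr_dist r \<gamma> (perturb a v c \<gamma>) \<le> c * (2 * (4 * pi) ^ r * norm v)"
  unfolding Cr_dist_le_iff[OF assms(1) perturb(1)[OF assms(1)]]
proof (intro allI impI)
  fix i t assume "i \<le> r"
  then have "c * (\<bar>bump a i t\<bar> * norm v) \<le> c * (2 * (4 * pi) ^ r * norm v)"
    using assms(2) by (intro mult_left_mono mult_right_mono bump_bound) auto
  then show "norm (nderiv i \<gamma> t - nderiv i (perturb a v c \<gamma>) t) \<le> c * (2 * (4 * pi) ^ r * norm v)"
    using \<open>i \<le> r\<close> assms by (simp add: perturb(2) abs_mult mult.assoc)
qed

text \<open>Terms of order \<open>c^2\<close> and \<open>c^3\<close> contain \<open>v\<close> at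
  least twice and vanish. The determinant is thus affine in \<open>c\<close>, and its slope is read
  off by comparing \<open>c = 1\<close> with \<open>c = 0\<close>.\<close>

lemma triple_product_affine:
  fixes x y z v :: "real^3" and a b d c :: real
  shows "cross3 (x + (c * a) *\<^sub>R v) (y + (c * b) *\<^sub>R v) \<bullet> (z + (c * d) *\<^sub>R v) =
    cross3 x y \<bullet> z + c * (cross3 (x + a *\<^sub>R v) (y + b *\<^sub>R v) \<bullet> (z + d *\<^sub>R v) - cross3 x y \<bullet> z)"
  by (simp add: cross_add_left cross_add_right cross_mult_left cross_mult_right
      inner_add_left inner_add_right dot_cross_self algebra_simps)

lemma torsion_det_perturb:
  assumes "\<gamma> \<in> Cr_curves r" "r \<ge> 4"
  shows "torsion_det (perturb a v c \<gamma>) t =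
      torsion_det \<gamma> t + c * (torsion_det (perturb a v 1 \<gamma>) t - torsion_det \<gamma> t)"
    "torsion_det' (perturb a v c \<gamma>) t =
      torsion_det' \<gamma> t + c * (torsion_det' (perturb a v 1 \<gamma>) t - torsion_det' \<gamma> t)"
  using assms triple_product_affine[of "nderiv 1 \<gamma> t" c _ v "nderiv 2 \<gamma> t"]
  by (simp_all add: torsion_det_def torsion_det'_def perturb(2))

section \<open>Density from local perturbations\<close>

text \<open>The order of quantifiers matters: \<open>\<eta>\<close> depends on
  \<open>\<gamma>\<close> and \<open>a\<close> only and serves every \<open>\<delta>\<close> near
  \<open>\<gamma>\<close>, so a finite cover can be fixed before any perturbation is made.\<close>

lemma local_perturbation:
  assumes \<gamma>: "\<gamma> \<in> Emb r" and r: "r \<ge> 4"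
  shows "\<exists>\<eta>>0. \<forall>\<delta>\<in>Cr_curves r. Cr_dist r \<gamma> \<delta> < \<eta> \<longrightarrow>
    (\<forall>\<epsilon>>0. \<exists>\<delta>'\<in>Cr_curves r. Cr_dist r \<delta> \<delta>' < \<epsilon> \<and> simple_zeros_on {a - \<eta>..a + \<eta>} \<delta>')"
proof -
  note E = EmbD[OF \<gamma>]
  define v where "v = cross3 (nderiv 1 \<gamma> a) (nderiv 2 \<gamma> a)"
  have v: "v \<noteq> 0" using E(6) by (simp add: v_def)
  define G where "G \<delta> t = torsion_det (perturb a v 1 \<delta>) t - torsion_det \<delta> t" for \<delta> t
  define G' where "G' \<delta> t = torsion_det' (perturb a v 1 \<delta>) t - torsion_det' \<delta> t" for \<delta> t
  \<comment> \<open>At \<open>a\<close> the bump changes only the third derivative, and by a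
    multiple of \<open>v\<close>; with this \<open>v\<close> the determinant grows by a multiple of
    \<open>v \<bullet> v\<close>.\<close>
  have "G \<gamma> a = 24 * pi ^ 3 * (v \<bullet> v)"
    using E(1) r by (simp add: G_def torsion_det_def perturb(2) bump_center inner_add_right del: One_nat_def flip: v_def)
  then have "G \<gamma> a \<noteq> 0" using v by simp
  \<comment> \<open>The compact set is a single point here; the slack in \<open>s\<close> supplies
    the interval around it.\<close>
  have "\<exists>\<eta>>0. \<forall>\<delta>\<in>Cr_curves r. Cr_dist r \<gamma> \<delta> < \<eta> \<longrightarrow> (\<forall>t\<in>{a}. \<forall>s. \<bar>s - t\<bar> \<le> \<eta> \<longrightarrow> \<not> G \<delta> s = 0)"
  proof (rule jet_condition_open[OF E(1)])
    fix \<delta> x t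
    assume x: "x \<longlonglongrightarrow> t" and \<delta>: "\<And>n. \<delta> n \<in> Cr_curves r"
      and lim: "\<And>i. i \<le> r \<Longrightarrow> (\<lambda>n. nderiv i (\<delta> n) (x n)) \<longlonglongrightarrow> nderiv i \<gamma> t"
      and 0: "\<And>n. G (\<delta> n) (x n) = 0"
    have "(\<lambda>n. bump a i (x n)) \<longlonglongrightarrow> bump a i t" for i
      by (rule isCont_tendsto_compose[OF DERIV_isCont[OF bump_has_derivative] x])
    note bump = this
    have "(\<lambda>n. nderiv i (perturb a v 1 (\<delta> n)) (x n)) \<longlonglongrightarrow> nderiv i (perturb a v 1 \<gamma>) t" if "i \<le> r" for i
      using that by (auto simp: perturb(2)[OF \<delta>] perturb(2)[OF E(1)] intro!: tendsto_intros lim bump)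
    then have "(\<lambda>n. G (\<delta> n) (x n)) \<longlonglongrightarrow> G \<gamma> t"
      unfolding G_def torsion_det_def using r by (intro tendsto_diff tendsto_inner tendsto_cross3 lim) auto
    then show "G \<gamma> t = 0" using 0 by (simp add: LIMSEQ_const_iff)
  qed (use \<open>G \<gamma> a \<noteq> 0\<close> in auto)
  then obtain \<eta> where \<eta>: "\<eta> > 0"
    "\<And>\<delta> t. \<delta> \<in> Cr_curves r \<Longrightarrow> Cr_dist r \<gamma> \<delta> < \<eta> \<Longrightarrow> \<bar>t - a\<bar> \<le> \<eta> \<Longrightarrow> G \<delta> t \<noteq> 0"
    by auto
  have "\<exists>\<delta>'\<in>Cr_curves r. Cr_dist r \<delta> \<delta>' < \<epsilon> \<and> simple_zeros_on {a - \<eta>..a + \<eta>} \<delta>'"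
    if \<delta>: "\<delta> \<in> Cr_curves r" "Cr_dist r \<gamma> \<delta> < \<eta>" and "\<epsilon> > 0" for \<delta> \<epsilon>
  proof -
    let ?I = "{a - \<eta>..a + \<eta>}"
    have G: "G \<delta> t \<noteq> 0" if "t \<in> ?I" for t using \<eta>(2)[OF \<delta>, of t] that by (auto simp: abs_le_iff)
    define M where "M = 2 * (4 * pi) ^ r * norm v"
    have M: "M > 0" using v by (simp add: M_def)
    have cr: "Cr r \<delta>" "Cr r (perturb a v 1 \<delta>)"
      using \<delta>(1) perturb(1)[OF \<delta>(1), of a v 1] by (auto simp: Cr_curves_def)
    have "((\<lambda>t. - torsion_det \<delta> t / G \<delta> t) has_real_derivative
        (- torsion_det' \<delta> t * G \<delta> t - (- torsion_det \<delta> t) * G' \<delta> t) / (G \<delta> t * G \<delta> t)) (at t within ?I)"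
      if "t \<in> ?I" for t
      using G[OF that] unfolding G_def G'_def
      by (intro DERIV_divide DERIV_minus DERIV_diff torsion_det_has_derivative[OF cr(1) r]
          torsion_det_has_derivative[OF cr(2) r])
    \<comment> \<open>\<open>c < \<epsilon> / M\<close> keeps the perturbation, of size at most
      \<open>c * M\<close>, below \<open>\<epsilon>\<close>.\<close>
    from regular_value_near_0[OF this, of "\<epsilon> / M"] obtain c where c: "0 < c" "c < \<epsilon> / M"
      "\<And>t. t \<in> ?I \<Longrightarrow> - torsion_det \<delta> t / G \<delta> t = c \<Longrightarrow>
        (- torsion_det' \<delta> t * G \<delta> t - (- torsion_det \<delta> t) * G' \<delta> t) / (G \<delta> t * G \<delta> t) \<noteq> 0"
      using \<open>\<epsilon> > 0\<close> M by (metis divide_pos_pos)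
    have "simple_zeros_on ?I (perturb a v c \<delta>)"
      unfolding simple_zeros_on_def
    proof (intro ballI disjCI notI)
      fix t assume t: "t \<in> ?I" and 1: "\<not> torsion_det' (perturb a v c \<delta>) t \<noteq> 0"
        and 0: "torsion_det (perturb a v c \<delta>) t = 0"
      \<comment> \<open>At a double zero, \<open>- torsion_det \<delta> / G \<delta>\<close> takes
        the value \<open>c\<close>, and the numerator of its derivative becomes
        \<open>c G' G - c G G' = 0\<close>, against the choice of \<open>c\<close>.\<close>
      have D: "torsion_det \<delta> t = - c * G \<delta> t" "torsion_det' \<delta> t = - c * G' \<delta> t"
        using 0 1 torsion_det_perturb[OF \<delta>(1) r, of a v c t] by (simp_all add: G_def G'_def)
      then show False using c(3)[OF t] G[OF t] by simp
    qed
    moreover have "Cr_dist r \<delta> (perturb a v c \<delta>) < \<epsilon>"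
    proof -
      have "Cr_dist r \<delta> (perturb a v c \<delta>) \<le> c * M"
        using perturb_dist[OF \<delta>(1)] c(1) by (simp add: M_def)
      also have "\<dots> < \<epsilon>" using c(2) M by (simp add: pos_less_divide_eq)
      finally show ?thesis .
    qed
    ultimately show ?thesis using perturb(1)[OF \<delta>(1)] by blast
  qed
  then show ?thesis using \<eta>(1) by blast
qed

text \<open>Induction over the finite cover: the next perturbation is smaller than the openness
  radius belonging to the arcs already treated.\<close>

lemma Gen_approximation:
  assumes \<gamma>: "\<gamma> \<in> Emb r" and r: "r \<ge> 4" and "\<epsilon> > 0"
  shows "\<exists>\<delta>\<in>Gen r. Cr_dist r \<gamma> \<delta> < \<epsilon>"
proof -
  interpret Metric_space "Cr_curves r" "Cr_dist r" by (rule Metric_space_Cr)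
  note E = EmbD[OF \<gamma>]
  obtain \<epsilon>0 where \<epsilon>0: "\<epsilon>0 > 0" "\<And>\<delta>. \<delta> \<in> Cr_curves r \<Longrightarrow> Cr_dist r \<gamma> \<delta> < \<epsilon>0 \<Longrightarrow> \<delta> \<in> Emb r"
    using Emb_open[OF \<gamma>] r by auto
  obtain \<eta> where \<eta>: "\<And>a. \<eta> a > 0" "\<And>a \<delta> e. \<delta> \<in> Cr_curves r \<Longrightarrow> Cr_dist r \<gamma> \<delta> < \<eta> a \<Longrightarrow> e > 0 \<Longrightarrow>
      \<exists>\<delta>'\<in>Cr_curves r. Cr_dist r \<delta> \<delta>' < e \<and> simple_zeros_on {a - \<eta> a..a + \<eta> a} \<delta>'"
    using local_perturbation[OF \<gamma> r] by metis
  obtain A where A: "A \<subseteq> {0..1}" "finite A" "{0..1} \<subseteq> (\<Union>a\<in>A. ball a (\<eta> a))"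
  proof (rule compactE_image[of "{0..1::real}" "{0..1}" "\<lambda>a. ball a (\<eta> a)"])
    show "{0..1} \<subseteq> (\<Union>a\<in>{0..1}. ball a (\<eta> a))" using \<eta>(1) by fastforce
  qed auto
  let ?K = "\<lambda>A. \<Union>a\<in>A. {a - \<eta> a..a + \<eta> a}"
  have "\<exists>\<delta>\<in>Cr_curves r. Cr_dist r \<gamma> \<delta> < e \<and> simple_zeros_on (?K A) \<delta>" if "e > 0" for e
    using A(2) that
  proof (induction A arbitrary: e rule: finite_induct)
    case empty
    then show ?case using E(1) by (intro bexI[of _ \<gamma>]) (auto simp: simple_zeros_on_def)
  next
    case (insert a A)
    \<comment> \<open>Half of \<open>e\<close> is reserved for the next step, and staying within
      \<open>\<eta> a\<close> of \<open>\<gamma>\<close> keeps the local perturbation at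
      \<open>a\<close> available.\<close>
    obtain \<delta> where \<delta>: "\<delta> \<in> Cr_curves r" "Cr_dist r \<gamma> \<delta> < min (e / 2) (\<eta> a)" "simple_zeros_on (?K A) \<delta>"
      using insert.IH[of "min (e / 2) (\<eta> a)"] insert.prems \<eta>(1)[of a] by auto
    have "compact (?K A)" using insert.hyps(1) by (intro compact_UN) auto
    then obtain \<epsilon>1 where \<epsilon>1: "\<epsilon>1 > 0" "\<And>\<delta>'. \<delta>' \<in> Cr_curves r \<Longrightarrow> Cr_dist r \<delta> \<delta>' < \<epsilon>1 \<Longrightarrow> simple_zeros_on (?K A) \<delta>'"
      using simple_zeros_on_open[OF \<delta>(1) r _ \<delta>(3)] by auto
    obtain \<delta>' where \<delta>': "\<delta>' \<in> Cr_curves r" "Cr_dist r \<delta> \<delta>' < min (e / 2) \<epsilon>1"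
      "simple_zeros_on {a - \<eta> a..a + \<eta> a} \<delta>'"
      using \<eta>(2)[OF \<delta>(1), of a "min (e / 2) \<epsilon>1"] \<delta>(2) insert.prems \<epsilon>1(1) by auto
    have "Cr_dist r \<gamma> \<delta>' < e"
      using triangle[OF E(1) \<delta>(1) \<delta>'(1)] \<delta>(2) \<delta>'(2) by auto
    moreover have "simple_zeros_on (?K (insert a A)) \<delta>'"
      using \<epsilon>1(2)[OF \<delta>'(1)] \<delta>'(2,3) by (auto simp: simple_zeros_on_def)
    ultimately show ?case using \<delta>'(1) by blast
  qed
  \<comment> \<open>The bound \<open>\<epsilon>0\<close> ensures that the final curve is still in
    \<open>Emb r\<close>.\<close>
  then obtain \<delta> where \<delta>: "\<delta> \<in> Cr_curves r" "Cr_dist r \<gamma> \<delta> < min \<epsilon> \<epsilon>0" "simple_zeros_on (?K A) \<delta>"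
    using \<epsilon>0(1) \<open>\<epsilon> > 0\<close> by (metis min_less_iff_conj)
  have "{0..1} \<subseteq> ?K A" using A(3) by (force simp: dist_real_def)
  then have "simple_zeros_on {0..1} \<delta>" using \<delta>(3) unfolding simple_zeros_on_def by blast
  moreover have "\<delta> \<in> Emb r" using \<epsilon>0(2) \<delta> by simp
  ultimately show ?thesis using \<delta>(2) r by (auto simp: Gen_iff)
qed

section \<open>Topology\<close>

text \<open>The subspace topology is the metric topology of the restricted distance, so balls
  relative to \<open>Emb r\<close> suffice.\<close>

lemma openin_Emb_top:
  "openin (Emb_top r) U \<longleftrightarrow> U \<subseteq> Emb r \<and> (\<forall>\<gamma>\<in>U. \<exists>\<epsilon>>0. \<forall>\<delta>\<in>Emb r. Cr_dist r \<gamma> \<delta> < \<epsilon> \<longrightarrow> \<delta> \<in> U)"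
proof -
  interpret Metric_space "Cr_curves r" "Cr_dist r" by (rule Metric_space_Cr)
  interpret Submetric "Cr_curves r" "Cr_dist r" "Emb r"
    by unfold_locales (auto simp: Emb_def)
  show ?thesis
    unfolding Emb_top_def mtopology_submetric[symmetric] sub.openin_mtopology sub.mball_def
    by blast
qed

lemma Gen_openin:
  assumes r: "r \<ge> 4"
  shows "openin (Emb_top r) (Gen r)"
  unfolding openin_Emb_top
proof (intro conjI ballI)
  show "Gen r \<subseteq> Emb r" by (auto simp: Gen_def)
  fix \<gamma> assume "\<gamma> \<in> Gen r"
  then have \<gamma>: "\<gamma> \<in> Emb r" "simple_zeros_on {0..1} \<gamma>" using r by (auto simp: Gen_iff)
  show "\<exists>\<epsilon>>0. \<forall>\<delta>\<in>Emb r. Cr_dist r \<gamma> \<delta> < \<epsilon> \<longrightarrow> \<delta> \<in> Gen r"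
    using simple_zeros_on_open[OF EmbD(1)[OF \<gamma>(1)] r _ \<gamma>(2)] r by (auto simp: Gen_iff EmbD(1))
qed

lemma Gen_dense:
  assumes r: "r \<ge> 4"
  shows "dense_in (Emb_top r) (Gen r)"
  unfolding dense_in_def topspace_Emb_top
proof (intro conjI equalityI subsetI)
  show "\<gamma> \<in> Emb r" if "\<gamma> \<in> Emb_top r closure_of Gen r" for \<gamma>
    using that by (metis in_closure_of topspace_Emb_top)
  show "\<gamma> \<in> Emb_top r closure_of Gen r" if "\<gamma> \<in> Emb r" for \<gamma>
    unfolding in_closure_of topspace_Emb_top openin_Emb_top
  proof (intro conjI allI impI)
    fix T assume T: "\<gamma> \<in> T \<and> T \<subseteq> Emb r \<and> (\<forall>\<gamma>\<in>T. \<exists>\<epsilon>>0. \<forall>\<delta>\<in>Emb r. Cr_dist r \<gamma> \<delta> < \<epsilon> \<longrightarrow> \<delta> \<in> T)"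
    then obtain \<epsilon> where "\<epsilon> > 0" "\<And>\<delta>. \<delta> \<in> Emb r \<Longrightarrow> Cr_dist r \<gamma> \<delta> < \<epsilon> \<Longrightarrow> \<delta> \<in> T" by blast
    moreover obtain \<delta> where "\<delta> \<in> Gen r" "Cr_dist r \<gamma> \<delta> < \<epsilon>"
      using Gen_approximation[OF \<open>\<gamma> \<in> Emb r\<close> r \<open>\<epsilon> > 0\<close>] by blast
    ultimately show "\<exists>y. y \<in> Gen r \<and> y \<in> T" by (auto simp: Gen_def)
  qed (use that in auto)
qed (auto simp: Gen_def)

lemma open_dense_imp_residual:
  assumes "openin X S" "dense_in X S"
  shows "residual_in X S"
  unfolding residual_in_def using assms by (intro conjI exI[of _ "{S}"]) (auto simp: dense_in_def)

text \<open>The quotient map is continuous and onto, and a continuous map sends the closure of a set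
  into the closure of its image.\<close>

lemma dense_in_quotient:
  assumes "dense_in X S"
  shows "dense_in (quotient_topology X q) (q ` S)"
proof -
  have "continuous_map X (quotient_topology X q) q"
    using quotient_map_quotient_topology by (rule quotient_imp_continuous_map)
  then have "q ` (X closure_of S) \<subseteq> quotient_topology X q closure_of (q ` S)"
    by (rule continuous_map_image_closure_subset)
  then show ?thesis
    using assms closure_of_subset_topspace[of "quotient_topology X q" "q ` S"]
    unfolding dense_in_def topspace_quotient_topology by auto
qed

section \<open>Reparametrisation\<close>

text \<open>The chain rule to third order. The derivatives of \<open>\<phi>\<close> enter as
  separate functions so that it serves both diffeomorphisms and the inverse of arclength.\<close>

lemma nderiv_comp:
  fixes \<gamma> :: "real \<Rightarrow> real^3"
  assumes "Cr r \<gamma>" "r \<ge> 3"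
    and \<phi>: "\<And>t. (\<phi> has_real_derivative \<phi>1 t) (at t)" "\<And>t. (\<phi>1 has_real_derivative \<phi>2 t) (at t)"
      "\<And>t. (\<phi>2 has_real_derivative \<phi>3 t) (at t)"
  shows "nderiv 1 (\<gamma> \<circ> \<phi>) t = \<phi>1 t *\<^sub>R nderiv 1 \<gamma> (\<phi> t)"
    "nderiv 2 (\<gamma> \<circ> \<phi>) t = \<phi>2 t *\<^sub>R nderiv 1 \<gamma> (\<phi> t) + (\<phi>1 t)\<^sup>2 *\<^sub>R nderiv 2 \<gamma> (\<phi> t)"
    "nderiv 3 (\<gamma> \<circ> \<phi>) t = \<phi>3 t *\<^sub>R nderiv 1 \<gamma> (\<phi> t) + (3 * \<phi>1 t * \<phi>2 t) *\<^sub>R nderiv 2 \<gamma> (\<phi> t)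
        + (\<phi>1 t) ^ 3 *\<^sub>R nderiv 3 \<gamma> (\<phi> t)"
    "i < 3 \<Longrightarrow> nderiv i (\<gamma> \<circ> \<phi>) differentiable (at t)"
proof -
  have comp: "((\<lambda>t. nderiv i \<gamma> (\<phi> t)) has_vector_derivative \<phi>1 t *\<^sub>R nderiv (Suc i) \<gamma> (\<phi> t)) (at t)"
    if "i < 3" for i t
    using vector_diff_chain_at[of \<phi> "\<phi>1 t" t "nderiv i \<gamma>" "nderiv (Suc i) \<gamma> (\<phi> t)"]
      Cr_nderiv_has[OF assms(1), of i "\<phi> t"] \<phi>(1)[of t] that assms(2)
    by (simp add: o_def has_real_derivative_iff_has_vector_derivative)
  have d: "((\<lambda>t. \<gamma> (\<phi> t)) has_vector_derivative \<phi>1 t *\<^sub>R nderiv 1 \<gamma> (\<phi> t)) (at t)"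
    "((\<lambda>t. nderiv 1 \<gamma> (\<phi> t)) has_vector_derivative \<phi>1 t *\<^sub>R nderiv 2 \<gamma> (\<phi> t)) (at t)"
    "((\<lambda>t. nderiv 2 \<gamma> (\<phi> t)) has_vector_derivative \<phi>1 t *\<^sub>R nderiv 3 \<gamma> (\<phi> t)) (at t)" for t
    using comp[of 0 t] comp[of 1 t] comp[of 2 t] by (simp_all add: numeral_eq_Suc)
  \<comment> \<open>The last branch also catches indices above 3, but only those up to 3 are
    evaluated.\<close>
  define F where "F i = (case i of 0 \<Rightarrow> \<gamma> \<circ> \<phi>
    | Suc 0 \<Rightarrow> \<lambda>t. \<phi>1 t *\<^sub>R nderiv 1 \<gamma> (\<phi> t)
    | Suc (Suc 0) \<Rightarrow> \<lambda>t. \<phi>2 t *\<^sub>R nderiv 1 \<gamma> (\<phi> t) + (\<phi>1 t)\<^sup>2 *\<^sub>R nderiv 2 \<gamma> (\<phi> t)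
    | _ \<Rightarrow> \<lambda>t. \<phi>3 t *\<^sub>R nderiv 1 \<gamma> (\<phi> t) + (3 * \<phi>1 t * \<phi>2 t) *\<^sub>R nderiv 2 \<gamma> (\<phi> t)
        + (\<phi>1 t) ^ 3 *\<^sub>R nderiv 3 \<gamma> (\<phi> t))" for i :: nat
  have sq: "((\<lambda>t. (\<phi>1 t)\<^sup>2) has_real_derivative 2 * \<phi>1 t * \<phi>2 t) (at t)" for t
    by (auto intro!: derivative_eq_intros \<phi>(2))
  have "(F i has_vector_derivative F (Suc i) t) (at t)" if "i < 3" for i t
  proof -
    consider "i = 0" | "i = 1" | "i = 2" using \<open>i < 3\<close> by linarith
    then show ?thesis
    proof cases
      case 2
      show ?thesis
        using has_vector_derivative_scaleR[OF \<phi>(2) d(2), of t]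
        by (simp add: F_def 2 power2_eq_square add.commute)
    next
      case 3
      have F2: "F 2 = (\<lambda>t. \<phi>2 t *\<^sub>R nderiv 1 \<gamma> (\<phi> t) + (\<phi>1 t)\<^sup>2 *\<^sub>R nderiv 2 \<gamma> (\<phi> t))"
        by (simp add: F_def numeral_2_eq_2)
      have F3: "F 3 t = (\<phi>2 t *\<^sub>R (\<phi>1 t *\<^sub>R nderiv 2 \<gamma> (\<phi> t)) + \<phi>3 t *\<^sub>R nderiv 1 \<gamma> (\<phi> t)) +
          ((\<phi>1 t)\<^sup>2 *\<^sub>R (\<phi>1 t *\<^sub>R nderiv 3 \<gamma> (\<phi> t)) + (2 * \<phi>1 t * \<phi>2 t) *\<^sub>R nderiv 2 \<gamma> (\<phi> t))"
        by (simp add: F_def numeral_eq_Suc vec_eq_iff algebra_simps)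
      have "(F 2 has_vector_derivative F 3 t) (at t)"
        unfolding F2 F3 by (intro has_vector_derivative_add has_vector_derivative_scaleR \<phi>(3) d sq)
      then show ?thesis by (simp add: 3)
    qed (use d(1)[of t] in \<open>simp add: F_def o_def\<close>)
  qed
  note F = this
  have n: "nderiv i (\<gamma> \<circ> \<phi>) = F i" if "i \<le> 3" for i
    using that
  proof (induction i)
    case (Suc i)
    then show ?case using vector_derivative_at[OF F[of i]] by (simp add: nderiv.simps(2))
  qed (simp add: F_def)
  show "nderiv 1 (\<gamma> \<circ> \<phi>) t = \<phi>1 t *\<^sub>R nderiv 1 \<gamma> (\<phi> t)"
    "nderiv 2 (\<gamma> \<circ> \<phi>) t = \<phi>2 t *\<^sub>R nderiv 1 \<gamma> (\<phi> t) + (\<phi>1 t)\<^sup>2 *\<^sub>R nderiv 2 \<gamma> (\<phi> t)"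
    "nderiv 3 (\<gamma> \<circ> \<phi>) t = \<phi>3 t *\<^sub>R nderiv 1 \<gamma> (\<phi> t) + (3 * \<phi>1 t * \<phi>2 t) *\<^sub>R nderiv 2 \<gamma> (\<phi> t)
        + (\<phi>1 t) ^ 3 *\<^sub>R nderiv 3 \<gamma> (\<phi> t)"
    using n[of 1] n[of 2] n[of 3] by (simp_all add: F_def numeral_eq_Suc)
  show "i < 3 \<Longrightarrow> nderiv i (\<gamma> \<circ> \<phi>) differentiable (at t)"
    using n[of i] F[of i t] by (auto intro: differentiableI_vector)
qed

text \<open>The terms in lower derivatives drop out: the cross product scales by
  \<open>\<phi>1^3\<close> and the determinant by \<open>\<phi>1^6\<close>, matching the squared
  norm in the denominator.\<close>

lemma torsion_comp:
  assumes "Cr r \<gamma>" "r \<ge> 3"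
    and \<phi>: "\<And>t. (\<phi> has_real_derivative \<phi>1 t) (at t)" "\<And>t. (\<phi>1 has_real_derivative \<phi>2 t) (at t)"
      "\<And>t. (\<phi>2 has_real_derivative \<phi>3 t) (at t)"
    and nz: "\<phi>1 t \<noteq> 0"
  shows "torsion (\<gamma> \<circ> \<phi>) t = torsion \<gamma> (\<phi> t)"
proof -
  note n = nderiv_comp(1-3)[OF assms(1-5), of t]
  have c: "cross3 (nderiv 1 (\<gamma> \<circ> \<phi>) t) (nderiv 2 (\<gamma> \<circ> \<phi>) t) =
      (\<phi>1 t) ^ 3 *\<^sub>R cross3 (nderiv 1 \<gamma> (\<phi> t)) (nderiv 2 \<gamma> (\<phi> t))"
    unfolding n by (simp add: cross_add_right cross_mult_left cross_mult_right power2_eq_square power3_eq_cube)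
  have "torsion_det (\<gamma> \<circ> \<phi>) t = ((\<phi>1 t) ^ 3)\<^sup>2 * torsion_det \<gamma> (\<phi> t)"
    unfolding torsion_det_def c unfolding n(3)
    by (simp add: inner_add_right dot_cross_self power2_eq_square)
  then show ?thesis
    unfolding torsion_eq c using nz by (simp add: power_mult_distrib)
qed

text \<open>Differentiating the identity \<open>inv \<phi> (\<phi> t) = t\<close> shows that the
  first derivative is nonzero; strict monotonicity alone would not.\<close>

lemma Diff_plus_derivatives:
  assumes "\<phi> \<in> Diff_plus r" "r \<ge> 3"
  shows "(\<phi> has_real_derivative nderiv 1 \<phi> t) (at t)"
    "(nderiv 1 \<phi> has_real_derivative nderiv 2 \<phi> t) (at t)"
    "(nderiv 2 \<phi> has_real_derivative nderiv 3 \<phi> t) (at t)"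
    "nderiv 1 \<phi> t \<noteq> 0"
proof -
  have \<phi>: "Cr r \<phi>" "Cr r (inv \<phi>)" "bij \<phi>" using assms(1) by (auto simp: Diff_plus_def)
  note d = Cr_has_vector_derivative[OF \<phi>(1), folded has_real_derivative_iff_has_vector_derivative]
  show d1: "(\<phi> has_real_derivative nderiv 1 \<phi> t) (at t)"
    "(nderiv 1 \<phi> has_real_derivative nderiv 2 \<phi> t) (at t)"
    "(nderiv 2 \<phi> has_real_derivative nderiv 3 \<phi> t) (at t)"
    using d assms(2) by auto
  have "(inv \<phi> has_real_derivative nderiv 1 (inv \<phi>) (\<phi> t)) (at (\<phi> t))"
    using Cr_has_vector_derivative(1)[OF \<phi>(2)] assms(2)
    by (simp add: has_real_derivative_iff_has_vector_derivative)
  then have "((\<lambda>t. inv \<phi> (\<phi> t)) has_real_derivative nderiv 1 (inv \<phi>) (\<phi> t) * nderiv 1 \<phi> t) (at t)"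
    using d1(1) by (rule DERIV_chain2)
  then have "((\<lambda>t. t) has_real_derivative nderiv 1 (inv \<phi>) (\<phi> t) * nderiv 1 \<phi> t) (at t)"
    using \<phi>(3) by (simp add: bij_is_inj)
  from DERIV_unique[OF this DERIV_ident] show "nderiv 1 \<phi> t \<noteq> 0" by auto
qed

lemma id_in_Diff_plus: "(\<lambda>t. t) \<in> Diff_plus r"
proof -
  define F :: "nat \<Rightarrow> real \<Rightarrow> real"
    where "F i = (case i of 0 \<Rightarrow> \<lambda>t. t | Suc 0 \<Rightarrow> \<lambda>t. 1 | _ \<Rightarrow> \<lambda>t. 0)" for i
  have "(F i has_vector_derivative F (Suc i) t) (at t)" for i t
    by (auto simp: F_def split: nat.split)
  moreover have "continuous_on UNIV (F r)"
    by (auto simp: F_def split: nat.split)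
  ultimately have "Cr r (F 0)" by (rule Cr_tower(1))
  moreover have "inv (\<lambda>t::real. t) = (\<lambda>t. t)" using inv_id by (simp add: id_def)
  moreover have "bij (\<lambda>t::real. t)" using bij_id by (simp add: id_def)
  ultimately show ?thesis by (simp add: Diff_plus_def F_def strict_mono_def)
qed

text \<open>The preimage of the image in the quotient is \<open>Gen r\<close> again, which is what
  openness in the quotient requires. Under reparametrisation the derivative of the torsion at a zero
  is multiplied by the nonzero derivative of \<open>\<phi>\<close>.\<close>

lemma Gen_saturated:
  assumes r: "r \<ge> 4"
  shows "{\<gamma> \<in> Emb r. reparam_class r \<gamma> \<in> reparam_class r ` Gen r} = Gen r"
proof (intro equalityI subsetI)
  fix \<gamma> assume "\<gamma> \<in> {\<gamma> \<in> Emb r. reparam_class r \<gamma> \<in> reparam_class r ` Gen r}"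
  then obtain \<delta> where \<gamma>: "\<gamma> \<in> Emb r" and \<delta>: "\<delta> \<in> Gen r" "reparam_class r \<gamma> = reparam_class r \<delta>"
    by blast
  \<comment> \<open>\<open>\<gamma>\<close> lies in its own class, hence in that of
    \<open>\<delta>\<close>.\<close>
  have "\<gamma> \<circ> (\<lambda>t. t) \<in> reparam_class r \<gamma>"
    unfolding reparam_class_def using id_in_Diff_plus by blast
  then obtain \<phi> where \<phi>: "\<phi> \<in> Diff_plus r" "\<gamma> = \<delta> \<circ> \<phi>"
    unfolding \<delta>(2) by (auto simp: reparam_class_def o_def)
  have \<delta>E: "\<delta> \<in> Emb r" and sz: "only_simple_zeros (torsion \<delta>)"
    using \<delta>(1) by (auto simp: Gen_def)
  have r3: "r \<ge> 3" using r by simp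
  note D = Diff_plus_derivatives[OF \<phi>(1) r3]
  have tor: "torsion \<gamma> = (\<lambda>t. torsion \<delta> (\<phi> t))"
    unfolding \<phi>(2) using torsion_comp[OF EmbD(2)[OF \<delta>E] r3 D(1-4)] by blast
  obtain d where d: "\<And>t. (torsion \<delta> has_real_derivative d t) (at t)"
    using torsion_has_derivative[OF EmbD(2)[OF \<delta>E] r EmbD(6)[OF \<delta>E]] by blast
  have "(torsion \<gamma> has_real_derivative d (\<phi> t) * nderiv 1 \<phi> t) (at t)" for t
    unfolding tor using d D(1) by (rule DERIV_chain2)
  note deriv_\<gamma> = DERIV_imp_deriv[OF this]
  have "only_simple_zeros (torsion \<gamma>)"
    using sz D(4) unfolding only_simple_zeros_def deriv_\<gamma> DERIV_imp_deriv[OF d] by (simp add: tor)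
  then show "\<gamma> \<in> Gen r" using \<gamma> by (simp add: Gen_def)
qed (auto simp: Gen_def)

section \<open>One global sign for functions of equal absolute value\<close>

lemma abs_eq_imp_eq_or_minus:
  fixes f g :: "real \<Rightarrow> real"
  assumes f: "\<And>t. (f has_real_derivative f' t) (at t)" "continuous_on UNIV f'"
    and g: "\<And>t. (g has_real_derivative g' t) (at t)" "continuous_on UNIV g'"
    and abs: "\<And>t. \<bar>f t\<bar> = \<bar>g t\<bar>" and simple: "\<And>t. g t = 0 \<Longrightarrow> g' t \<noteq> 0"
  shows "f = g \<or> f = (\<lambda>t. - g t)"
proof -
  \<comment> \<open>With values alone the two sets would meet at zeros of \<open>g\<close>; the
    derivatives keep them disjoint there.\<close>
  define A where "A = {t. f t = g t \<and> f' t = g' t}"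
  define B where "B = {t. f t = - g t \<and> f' t = - g' t}"
  have cf: "continuous_on UNIV f" "continuous_on UNIV g"
    using f(1) g(1) by (meson DERIV_isCont continuous_at_imp_continuous_on)+
  have "closed A" "closed B"
    unfolding A_def B_def using cf f(2) g(2)
    by (auto intro!: closed_Collect_conj closed_Collect_eq continuous_intros)
  moreover have "A \<inter> B = {}" using simple by (auto simp: A_def B_def)
  moreover have "A \<union> B = UNIV"
  proof -
    have "t \<in> A \<union> B" for t
    proof (cases "g t = 0")
      case True
      have "f t = 0" using abs[of t] True by simp
      \<comment> \<open>At a common zero the difference quotients agree in absolute value, and so do
        their limits.\<close>
      have "\<bar>(f (t + h) - f t) / h\<bar> = \<bar>(g (t + h) - g t) / h\<bar>" for h
        using abs[of "t + h"] True \<open>f t = 0\<close> by (simp add: abs_divide)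
      with tendsto_rabs[OF f(1)[of t, unfolded DERIV_def]]
      have "((\<lambda>h. \<bar>(g (t + h) - g t) / h\<bar>) \<longlongrightarrow> \<bar>f' t\<bar>) (at 0)" by (simp only:)
      from tendsto_unique[OF at_neq_bot this tendsto_rabs[OF g(1)[of t, unfolded DERIV_def]]]
      have "\<bar>f' t\<bar> = \<bar>g' t\<bar>" .
      then show ?thesis using True \<open>f t = 0\<close> by (auto simp: A_def B_def abs_eq_iff)
    next
      case False
      \<comment> \<open>Away from zeros, differentiating the equal squares gives
        \<open>f f' = g g'\<close>, so the derivatives carry the same sign as the values.\<close>
      have "f s * f s = g s * g s" for s using abs[of s] by (metis abs_mult_self_eq)
      then have "((\<lambda>s. g s * g s) has_real_derivative f' t * f t + f' t * f t) (at t)"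
        using DERIV_mult[OF f(1) f(1), of t] by simp
      from DERIV_unique[OF this DERIV_mult[OF g(1) g(1)]] have "f' t * f t = g' t * g t" by (simp add: mult.commute)
      moreover have "f t = g t \<or> f t = - g t" using abs[of t] by (simp add: abs_eq_iff)
      moreover have "f' t = - g' t" if "f' t * - g t = g' t * g t"
      proof -
        have "(f' t + g' t) * g t = 0" using that by (simp add: algebra_simps)
        then show ?thesis using False by (simp add: eq_neg_iff_add_eq_0)
      qed
      ultimately show ?thesis using False by (auto simp: A_def B_def)
    qed
    then show ?thesis by blast
  qed
  ultimately have "A = {} \<or> B = {}"
    using connected_UNIV[where 'a = real] unfolding connected_closed by (metis Int_UNIV_right subset_refl)
  with \<open>A \<union> B = UNIV\<close> have "A = UNIV \<or> B = UNIV" by auto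
  then show ?thesis by (auto simp: A_def B_def)
qed

section \<open>Arclength\<close>

lemma periodic_positive_lower_bound:
  fixes f :: "real \<Rightarrow> real"
  assumes "continuous_on UNIV f" "periodic 1 f" "\<And>t. f t > 0"
  obtains m where "m > 0" "\<And>t. f t \<ge> m"
proof -
  have "\<exists>x\<in>{0..1}. \<forall>y\<in>{0..1}. f x \<le> f y"
    by (intro continuous_attains_inf continuous_on_subset[OF assms(1)]) auto
  then obtain x where x: "\<And>y. y \<in> {0..1} \<Longrightarrow> f x \<le> f y" by blast
  have "f x \<le> f t" for t
    using x[of "frac t"] frac_lt_1[of t] periodic_1_frac[OF assms(2), of t] by simp
  then show ?thesis using that assms(3) by blast
qed

text \<open>The speed has a positive lower bound by periodicity, so arclength grows at least
  linearly in both directions and is a bijection of the line.\<close>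

lemma arclength_inverse:
  assumes "Cr r \<gamma>" "r \<ge> 1" "periodic 1 \<gamma>" "\<And>t. nderiv 1 \<gamma> t \<noteq> 0"
  shows "((inv (arclength \<gamma>)) has_real_derivative inverse (norm (nderiv 1 \<gamma> (inv (arclength \<gamma>) s)))) (at s)"
    (is "(?\<phi> has_real_derivative _) _")
proof -
  define f where "f t = norm (nderiv 1 \<gamma> t)" for t
  have cont: "continuous_on UNIV f"
    unfolding f_def by (intro continuous_intros Cr_nderiv_continuous[OF assms(1,2)])
  have "periodic 1 f"
    using periodic_nderiv[OF assms(1,3,2)] by (simp add: f_def periodic_def)
  then obtain m where m: "m > 0" "\<And>t. f t \<ge> m"
    using periodic_positive_lower_bound[OF cont] assms(4) by (auto simp: f_def)
  have d: "(arclength \<gamma> has_real_derivative f t) (at t)" for t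
  proof -
    \<comment> \<open>An interval with both 0 and \<open>t\<close> in its interior, so that the
      restriction can be removed afterwards.\<close>
    have "((\<lambda>u. LBINT y=ereal 0..ereal u. f y) has_vector_derivative f t) (at t within {-\<bar>t\<bar> - 1..\<bar>t\<bar> + 1})"
      by (rule interval_integral_FTC2) (auto intro: continuous_on_subset[OF cont])
    then have "((\<lambda>u. LBINT y=ereal 0..ereal u. f y) has_vector_derivative f t) (at t)"
      by (subst (asm) at_within_interior) auto
    then show ?thesis
      by (simp add: arclength_def[abs_def] f_def has_real_derivative_iff_has_vector_derivative zero_ereal_def)
  qed
  have fpos: "f t > 0" for t using m less_le_trans by blast
  have isc: "isCont (arclength \<gamma>) t" for t using d by (rule DERIV_isCont)
  have mono: "strict_mono (arclength \<gamma>)"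
    by (rule strict_monoI) (use DERIV_pos_imp_increasing[OF _ ] d fpos in blast)
  have growth: "m * (b - a) \<le> arclength \<gamma> b - arclength \<gamma> a" if "a \<le> b" for a b
  proof -
    have "((\<lambda>t. arclength \<gamma> t - m * t) has_real_derivative f t - m) (at t)" for t
      by (auto intro!: derivative_eq_intros d)
    then have "arclength \<gamma> a - m * a \<le> arclength \<gamma> b - m * b"
      using that m(2) by (intro DERIV_nonneg_imp_nondecreasing[of a b "\<lambda>t. arclength \<gamma> t - m * t"])
        (auto intro!: exI)
    then show ?thesis by (simp add: algebra_simps)
  qed
  have "surj (arclength \<gamma>)"
  proof -
    have "\<exists>t. arclength \<gamma> t = y" for y
    proof -
      \<comment> \<open>The linear growth rate \<open>m\<close> makes arclength pass
        \<open>y\<close> within distance \<open>b\<close> of 0.\<close>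
      define b where "b = \<bar>y - arclength \<gamma> 0\<bar> / m"
      have b: "b \<ge> 0" "m * b = \<bar>y - arclength \<gamma> 0\<bar>" using m(1) by (auto simp: b_def)
      have "arclength \<gamma> (- b) \<le> y" "y \<le> arclength \<gamma> b"
        using growth[of "-b" 0] growth[of 0 b] b by auto
      then show ?thesis
        using IVT'[of "arclength \<gamma>" "-b" y b] isc b(1) by (auto intro: continuous_at_imp_continuous_on)
    qed
    then show ?thesis by (metis surjI)
  qed
  then have bij: "bij (arclength \<gamma>)" using mono by (simp add: bij_def strict_mono_imp_inj_on)
  have "isCont ?\<phi> s"
  proof -
    have "isCont ?\<phi> (arclength \<gamma> (?\<phi> s))"
      by (rule isCont_inverse_function[where d = 1])
        (use bij isc in \<open>auto simp: bij_is_inj\<close>)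
    then show ?thesis using bij by (simp add: bij_is_surj surj_f_inv_f)
  qed
  then have "(?\<phi> has_real_derivative inverse (f (?\<phi> s))) (at s)"
    using d fpos[of "?\<phi> s"] bij
    by (intro DERIV_inverse_function[where a = "s - 1" and b = "s + 1" and f = "arclength \<gamma>"])
      (auto simp: bij_is_surj surj_f_inv_f)
  then show ?thesis by (simp add: f_def)
qed

lemma arclength_reparam:
  assumes \<gamma>: "\<gamma> \<in> Emb r" and r: "r \<ge> 4"
  defines "c \<equiv> arclength_reparam \<gamma>" and "\<phi> \<equiv> inv (arclength \<gamma>)"
  shows "i < 3 \<Longrightarrow> nderiv i c differentiable (at t)" "norm (nderiv 1 c t) = 1"
    "torsion c t = torsion \<gamma> (\<phi> t)" "(\<phi> has_real_derivative inverse (norm (nderiv 1 \<gamma> (\<phi> t)))) (at t)"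
proof -
  note E = EmbD[OF \<gamma>]
  \<comment> \<open>The squared speed, differentiable as an inner product; \<open>v1\<close> and
    \<open>v2\<close> are its derivatives.\<close>
  define v where "v t = nderiv 1 \<gamma> t \<bullet> nderiv 1 \<gamma> t" for t
  define v1 where "v1 t = 2 * (nderiv 1 \<gamma> t \<bullet> nderiv 2 \<gamma> t)" for t
  define v2 where "v2 t = 2 * (nderiv 2 \<gamma> t \<bullet> nderiv 2 \<gamma> t + nderiv 1 \<gamma> t \<bullet> nderiv 3 \<gamma> t)" for t
  have v: "v t > 0" for t using E(4) by (simp add: v_def)
  have n: "norm (nderiv 1 \<gamma> t) = sqrt (v t)" for t by (simp add: v_def norm_eq_sqrt_inner)
  note dd = Cr_has_vector_derivative[OF E(2)]
  have dv: "(v has_real_derivative v1 t) (at t)" "(v1 has_real_derivative v2 t) (at t)" for t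
  proof -
    have d: "(nderiv 1 \<gamma> has_vector_derivative nderiv 2 \<gamma> t) (at t)"
      "(nderiv 2 \<gamma> has_vector_derivative nderiv 3 \<gamma> t) (at t)" using dd r by auto
    show "(v has_real_derivative v1 t) (at t)"
      using has_vector_derivative_inner[OF d(1) d(1)]
      by (simp add: v_def[abs_def] v1_def inner_commute has_real_derivative_iff_has_vector_derivative)
    show "(v1 has_real_derivative v2 t) (at t)"
      using DERIV_cmult[OF has_vector_derivative_inner[OF d(1) d(2),
          folded has_real_derivative_iff_has_vector_derivative], of 2]
      by (simp add: v1_def[abs_def] v2_def add.commute)
  qed
  show d: "(\<phi> has_real_derivative inverse (norm (nderiv 1 \<gamma> (\<phi> t)))) (at t)" for t
    unfolding \<phi>_def using r by (intro arclength_inverse[OF E(2) _ E(3,4)]) auto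
  \<comment> \<open>From \<open>\<phi>' = v^(-1/2)\<close> along \<open>\<phi>\<close>, the chain
    rule gives \<open>\<phi>'' = - v1 / (2 v^2)\<close>; the quotient rule then gives
    \<open>\<phi>3\<close>.\<close>
  define \<phi>1 where "\<phi>1 t = inverse (sqrt (v (\<phi> t)))" for t
  define \<phi>2 where "\<phi>2 t = - v1 (\<phi> t) / (2 * (v (\<phi> t))\<^sup>2)" for t
  define \<phi>3 where "\<phi>3 t = (- (v2 (\<phi> t) * \<phi>1 t) * (2 * (v (\<phi> t))\<^sup>2)
      - (- v1 (\<phi> t)) * (4 * v (\<phi> t) * (v1 (\<phi> t) * \<phi>1 t))) / ((2 * (v (\<phi> t))\<^sup>2) * (2 * (v (\<phi> t))\<^sup>2))" for t
  have 1: "(\<phi> has_real_derivative \<phi>1 t) (at t)" for t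
    using d[of t] by (simp add: \<phi>1_def n del: One_nat_def)
  have dvp: "((\<lambda>t. v (\<phi> t)) has_real_derivative v1 (\<phi> t) * \<phi>1 t) (at t)"
    "((\<lambda>t. v1 (\<phi> t)) has_real_derivative v2 (\<phi> t) * \<phi>1 t) (at t)" for t
    using DERIV_chain2[OF dv(1) 1] DERIV_chain2[OF dv(2) 1] by auto
  have 2: "(\<phi>1 has_real_derivative \<phi>2 t) (at t)" for t
  proof -
    have "((\<lambda>t. sqrt (v (\<phi> t))) has_real_derivative (inverse (sqrt (v (\<phi> t))) / 2) * (v1 (\<phi> t) * \<phi>1 t)) (at t)"
      by (rule DERIV_chain2[OF DERIV_real_sqrt[OF v] dvp(1)])
    from DERIV_inverse'[OF this] have "(\<phi>1 has_real_derivative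
       - (inverse (sqrt (v (\<phi> t))) * ((inverse (sqrt (v (\<phi> t))) / 2) * (v1 (\<phi> t) * \<phi>1 t)) * inverse (sqrt (v (\<phi> t))))) (at t)"
      using v[of "\<phi> t"] by (simp add: \<phi>1_def[abs_def])
    moreover have "- (inverse (sqrt (v (\<phi> t))) * ((inverse (sqrt (v (\<phi> t))) / 2) * (v1 (\<phi> t) * \<phi>1 t)) * inverse (sqrt (v (\<phi> t)))) = \<phi>2 t"
    proof -
      have "\<phi>1 t * \<phi>1 t = inverse (sqrt (v (\<phi> t)) * sqrt (v (\<phi> t)))"
        unfolding \<phi>1_def by (rule inverse_mult_distrib[symmetric])
      also have "\<dots> = inverse (v (\<phi> t))" using v[of "\<phi> t"] by (simp only: real_sqrt_mult_self abs_of_pos)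
      finally have ww: "\<phi>1 t * \<phi>1 t = inverse (v (\<phi> t))" .
      have "- (\<phi>1 t * ((\<phi>1 t / 2) * (v1 (\<phi> t) * \<phi>1 t)) * \<phi>1 t) =
          - (v1 (\<phi> t) * ((\<phi>1 t * \<phi>1 t) * (\<phi>1 t * \<phi>1 t)) / 2)" by (simp add: mult_ac)
      also have "\<dots> = \<phi>2 t"
        unfolding ww \<phi>2_def power2_eq_square divide_inverse inverse_mult_distrib by (simp only: mult_ac minus_mult_left)
      finally show ?thesis unfolding \<phi>1_def .
    qed
    ultimately show ?thesis by simp
  qed
  have 3: "(\<phi>2 has_real_derivative \<phi>3 t) (at t)" for t
  proof -
    have "((\<lambda>t. 2 * (v (\<phi> t))\<^sup>2) has_real_derivative 4 * v (\<phi> t) * (v1 (\<phi> t) * \<phi>1 t)) (at t)"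
      by (auto intro!: derivative_eq_intros dvp)
    moreover have "2 * (v (\<phi> t))\<^sup>2 \<noteq> 0" using v[of "\<phi> t"] by simp
    ultimately show ?thesis
      unfolding \<phi>2_def[abs_def] \<phi>3_def by (intro DERIV_divide DERIV_minus dvp(2))
  qed
  have c: "c = \<gamma> \<circ> \<phi>" by (simp add: c_def \<phi>_def arclength_reparam_def)
  have r3: "r \<ge> 3" using r by simp
  have p1: "\<phi>1 t > 0" for t using v by (simp add: \<phi>1_def)
  show "i < 3 \<Longrightarrow> nderiv i c differentiable (at t)"
    unfolding c by (rule nderiv_comp(4)[OF E(2) r3 1 2 3])
  show "norm (nderiv 1 c t) = 1"
    unfolding c nderiv_comp(1)[OF E(2) r3 1 2 3] using v[of "\<phi> t"] by (simp add: n \<phi>1_def del: One_nat_def)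
  show "torsion c t = torsion \<gamma> (\<phi> t)"
    unfolding c using p1[of t] by (intro torsion_comp[OF E(2) r3 1 2 3]) auto
qed

section \<open>Rigidity and assembly of the theorem\<close>

text \<open>The torsion of the arclength curve is that of \<open>\<gamma>\<close> composed with a
  map of positive derivative, so it is continuously differentiable with simple zeros.
  \<open>Cr 4 \<eta>\<close> makes the other torsion continuously differentiable too, so the sign
  dichotomy applies.\<close>

lemma generic_curve_rigid:
  assumes r: "r \<ge> 4" and \<gamma>: "\<gamma> \<in> Gen r"
    and \<eta>: "Cr 4 \<eta>" "\<And>s. norm (nderiv 1 \<eta> s) = 1" "\<And>s. curvature \<eta> s > 0"
      "\<And>s. curvature \<eta> s = curvature (arclength_reparam \<gamma>) s"
      "\<And>s. \<bar>torsion \<eta> s\<bar> = \<bar>torsion (arclength_reparam \<gamma>) s\<bar>"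
  shows "\<exists>(Q :: real^3^3) (a :: real^3). orthogonal_matrix Q \<and>
           (\<forall>s. \<eta> s = Q *v arclength_reparam \<gamma> s + a)"
proof -
  let ?c = "arclength_reparam \<gamma>" and ?\<phi> = "inv (arclength \<gamma>)"
  have E: "\<gamma> \<in> Emb r" and sz: "only_simple_zeros (torsion \<gamma>)" using \<gamma> by (auto simp: Gen_def)
  note a = arclength_reparam[OF E r]
  obtain d where d: "continuous_on UNIV d" "\<And>t. (torsion \<gamma> has_real_derivative d t) (at t)"
    using torsion_has_derivative[OF EmbD(2)[OF E] r EmbD(6)[OF E]] by blast
  have "cross3 (nderiv 1 \<eta> t) (nderiv 2 \<eta> t) \<noteq> 0" for t
    using \<eta>(3)[of t] by (auto simp: curvature_def)
  from torsion_has_derivative[OF \<eta>(1) order_refl this] obtain e where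
    e: "continuous_on UNIV e" "\<And>t. (torsion \<eta> has_real_derivative e t) (at t)" by blast
  have tor: "torsion ?c = (\<lambda>t. torsion \<gamma> (?\<phi> t))" using a(3) by blast
  define d' where "d' t = d (?\<phi> t) * inverse (norm (nderiv 1 \<gamma> (?\<phi> t)))" for t
  have c\<phi>: "continuous_on UNIV ?\<phi>"
    using a(4) by (meson DERIV_isCont continuous_at_imp_continuous_on)
  have "continuous_on UNIV (\<lambda>t. nderiv 1 \<gamma> (?\<phi> t))"
    using r by (intro continuous_on_compose2[OF Cr_nderiv_continuous[OF EmbD(2)[OF E]] c\<phi>]) auto
  then have cd: "continuous_on UNIV d'"
    unfolding d'_def using EmbD(4)[OF E]
    by (intro continuous_intros continuous_on_compose2[OF d(1) c\<phi>]) auto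
  have "torsion \<eta> = torsion ?c \<or> torsion \<eta> = (\<lambda>t. - torsion ?c t)"
  proof (rule abs_eq_imp_eq_or_minus[OF e(2,1) _ cd \<eta>(5)])
    show "(torsion ?c has_real_derivative d' t) (at t)" for t
      unfolding tor d'_def using d(2) a(4) by (rule DERIV_chain2)
    show "d' t \<noteq> 0" if "torsion ?c t = 0" for t
      using that sz EmbD(4)[OF E] by (auto simp: d'_def tor only_simple_zeros_def DERIV_imp_deriv[OF d(2)])
  qed
  then show ?thesis
    using \<eta>(1,4) a(1,2) by (intro congruent_if_curvature_torsion \<eta>(2,3)) (auto simp: Cr_def)
qed

theorem theoremC:
  fixes r :: nat
  assumes "r \<ge> 4"
  shows "openin (Emb_top r) (Gen r) \<and>
     dense_in (Emb_top r) (Gen r) \<and>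
     residual_in (Emb_top r) (Gen r) \<and>
     openin (Emb_quotient r) (reparam_class r ` Gen r) \<and>
     dense_in (Emb_quotient r) (reparam_class r ` Gen r) \<and>
     (\<forall>\<gamma>\<in>Gen r. \<forall>\<eta> :: real \<Rightarrow> real^3.
        Cr 4 \<eta> \<and> periodic (curve_length \<gamma>) \<eta> \<and>
        (\<forall>s. norm (nderiv 1 \<eta> s) = 1) \<and>
        (\<forall>s. curvature \<eta> s > 0) \<and>
        (\<forall>s. curvature \<eta> s = curvature (arclength_reparam \<gamma>) s) \<and>
        (\<forall>s. \<bar>torsion \<eta> s\<bar> = \<bar>torsion (arclength_reparam \<gamma>) s\<bar>)
        \<longrightarrow> (\<exists>(Q :: real^3^3) (a :: real^3). orthogonal_matrix Q \<and>
              (\<forall>s. \<eta> s = Q *v arclength_reparam \<gamma> s + a)))"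
proof (intro conjI)
  note o = Gen_openin[OF assms] and d = Gen_dense[OF assms]
  show "openin (Emb_top r) (Gen r)" "dense_in (Emb_top r) (Gen r)" by (rule o d)+
  show "residual_in (Emb_top r) (Gen r)" using o d by (rule open_dense_imp_residual)
  \<comment> \<open>Saturation identifies the preimage to be tested with
    \<open>Gen r\<close>.\<close>
  show "openin (Emb_quotient r) (reparam_class r ` Gen r)"
    using o Gen_saturated[OF assms]
    by (auto simp: Emb_quotient_def openin_quotient_topology topspace_Emb_top dest: openin_subset)
  show "dense_in (Emb_quotient r) (reparam_class r ` Gen r)"
    unfolding Emb_quotient_def using d by (rule dense_in_quotient)
qed (use generic_curve_rigid[OF assms] in blast)

end
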